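(* Let $0 \le k < d$ be integers and let $\mu_0, \dots, \mu_{d-1}$ be probability measures on $\mathbb{C}^d$ which are absolutely continuous with respect to the Lebesgue measure. Then there exists a flag of complex affine subspaces \[ V_k \subseteq V_{k+1} \subseteq \dots \subseteq V_{d-1} \subseteq \mathbb{C}^d \] of respective complex dimensions $k, k+1, \dots, d-1$, such that $V_k$ is a complex central $k$-transversal for each of $\mu_0, \dots, \mu_k$, and $V_i$ is a complex central $i$-transversal for $\mu_i$, for each $i = k+1, \dots, d-1$.
   Context: For a measure $\mu$ on $\mathbb{C}^d$ and $0\le j<d$, a complex affine $j$-dimensional subspace $V \subseteq \mathbb{C}^d$ is a complex central $j$-transversal of $\mu$ if $\mu(H) \ge 1/(2d-2j+1)$ for every closed real halfspace $H \supseteq V$ of $\mathbb{C}^d \cong \mathbb{R}^{2d}$. *)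

theory Defs
  imports "HOL-Probability.Probability"
begin

text \<open>Complex \<open>d\<close>-space is \<open>complex ^ 'd\<close> with \<open>d = CARD('d)\<close>. The prefix \<open>vec\<close> refers to its
  structure as a vector space over the complex numbers, whereas \<open>\<bullet>\<close> and \<^const>\<open>lborel\<close> refer to
  its structure as a real Euclidean space of dimension \<open>2 * d\<close>.\<close>

definition complex_affine_subspace :: "nat \<Rightarrow> (complex ^ 'd) set \<Rightarrow> bool" where
  "complex_affine_subspace j V \<longleftrightarrow>
     (\<exists>a W. vec.subspace W \<and> vec.dim W = j \<and> V = (\<lambda>w. a + w) ` W)"

definition closed_real_halfspace :: "(complex ^ 'd) set \<Rightarrow> bool" where
  "closed_real_halfspace H \<longleftrightarrow> (\<exists>a b. a \<noteq> 0 \<and> H = {x. a \<bullet> x \<le> b})"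

definition complex_central_transversal ::
    "(complex ^ 'd) measure \<Rightarrow> nat \<Rightarrow> (complex ^ 'd) set \<Rightarrow> bool" where
  "complex_central_transversal \<mu> j V \<longleftrightarrow>
     j < CARD('d) \<and> complex_affine_subspace j V \<and>
     (\<forall>H. closed_real_halfspace H \<and> V \<subseteq> H \<longrightarrow>
        measure \<mu> H \<ge> 1 / (2 * real CARD('d) - 2 * real j + 1))"

end

theory Submission
  imports Defs "HOL-Number_Theory.Cong" "HOL-Real_Asymp.Real_Asymp"
begin

text \<open>
  For a unitary frame \<open>v\<^sub>0, \<dots>, v\<^bsub>d-1\<^esub>\<close> let \<open>W\<^sub>i\<close> be the complex span of \<open>v\<^sub>0, \<dots>, v\<^bsub>i-1\<^esub>\<close> and \<open>L\<^sub>i\<close> its orthogonal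
  complement. By Helly's theorem in \<open>L\<^sub>i\<close> each measure has a centre point relative to the halfspaces with
  normal in \<open>L\<^sub>i\<close>; up to an arbitrarily small loss of depth, such points \<open>p\<^sub>i(v)\<close> can be chosen continuously in \<open>v\<close>
  and invariant under \<open>v\<^sub>j \<mapsto> -v\<^sub>j\<close>. The flag \<open>p\<^sub>0(v) + W\<^sub>i\<close> works once \<open>p\<^sub>i(v) - p\<^sub>0(v)\<close> is orthogonal to
  \<open>v\<^sub>j\<close> for all \<open>1 \<le> i \<le> j\<close>. Together with the orthogonality of the rows these are equations on a product of \<open>d\<close>
  spheres of dimension \<open>2d - 1\<close>, each odd or even under every \<open>v\<^sub>j \<mapsto> -v\<^sub>j\<close>. They have a common zero because the
  mod 2 Euler class, the product of the corresponding linear forms in the degree one generators \<open>x\<^sub>j\<close>, contains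
  the monomial \<open>\<Prod>\<^sub>j x\<^sub>j\<^bsup>2d-1\<^esup>\<close> exactly once. This
  Borsuk-Ulam statement is proved by evaluating a cup product of one-cochains (sign changes along edges) on the
  barycentric subdivision of a product of cube boundaries, modulo the sign changes of the rows.
\<close>

section \<open>The face poset of a product of cube boundaries\<close>

text \<open>Being an exact centre point is not an open condition on the frame, so a partition of
  unity cannot select such points. Depth greater than \<open>t - e\<close> is open, because bounding
  hyperplanes are null sets, and the loss \<open>e\<close> disappears in a limit: the approximate
  centres lie in one ball chosen before \<open>e\<close>, and unitary frames form a compact set. The
  topological input is reduced to a parity count on a finite complex. Cubes replace spheres because
  cells then are integer vectors and row sign changes are negations. These act freely, so a count
  modulo 2 in the quotient becomes a count upstairs modulo 2^(R+1), with R rows. The constant 2d -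
  2i + 1 is the Helly number of the complement of W_i, whose real dimension is 2(d - i). Measure 0
  serves as reference, so only d - 1 differences of centres have to be controlled, which leaves room
  for the orthogonality equations. To serve the measures 0, ..., k by one flat, measure i is tested
  against W_m with m = max i k; the equations for i still suffice, as they concern all rows of rank
  at least i and i \<le> m.\<close>

text \<open>An integer point \<open>p\<close> encodes a cell of the product over \<open>r\<close> of the boundaries of \<open>[-M, M]\<^sup>c\<close>, \<open>M\<close> even,
  subdivided into cubes of side 2: an even coordinate is a vertex, an odd one the midpoint of an edge.\<close>

definition cells :: "int \<Rightarrow> ('r \<times> 'c \<Rightarrow> int) set" where
  "cells M = {p. \<forall>r. (\<forall>c. \<bar>p (r, c)\<bar> \<le> M) \<and> (\<exists>c. \<bar>p (r, c)\<bar> = M)}"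

text \<open>Upward covers: \<open>p\<close> is a facet of each \<open>q\<close>. Chains therefore
  start at a vertex and climb in dimension, and the maximal ones are the top simplices of the
  barycentric subdivision.\<close>

definition covers :: "int \<Rightarrow> ('r \<times> 'c \<Rightarrow> int) \<Rightarrow> ('r \<times> 'c \<Rightarrow> int) set" where
  "covers M p = {q \<in> cells M. \<exists>i. even (p i) \<and> \<bar>q i - p i\<bar> = 1 \<and> (\<forall>j. j \<noteq> i \<longrightarrow> q j = p j)}"

definition cell_dim :: "('i \<Rightarrow> int) \<Rightarrow> nat" where
  "cell_dim p = card {i. odd (p i)}"

definition flip :: "'r \<Rightarrow> ('r \<times> 'c \<Rightarrow> int) \<Rightarrow> ('r \<times> 'c \<Rightarrow> int)" where
  "flip r p = (\<lambda>i. if fst i = r then - p i else p i)"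

lemma flip_flip [simp]: "flip r (flip r p) = p"
  by (auto simp: flip_def fun_eq_iff)

lemma flip_in_cells [simp]: "flip r p \<in> cells M \<longleftrightarrow> p \<in> cells M"
proof -
  have "\<bar>flip r p i\<bar> = \<bar>p i\<bar>" for i by (simp add: flip_def)
  then show ?thesis by (simp add: cells_def)
qed

lemma cell_dim_flip [simp]: "cell_dim (flip r p) = cell_dim p"
proof -
  have "odd (flip r p i) = odd (p i)" for i by (simp add: flip_def)
  then show ?thesis by (simp add: cell_dim_def)
qed

lemma finite_cells [simp]: "finite (cells M :: ('r::finite \<times> 'c::finite \<Rightarrow> int) set)"
proof (rule finite_subset)
  show "(cells M :: ('r \<times> 'c \<Rightarrow> int) set) \<subseteq> PiE UNIV (\<lambda>_. {-M..M})"
    by (auto simp: cells_def abs_le_iff minus_le_iff)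
  show "finite (PiE (UNIV :: ('r \<times> 'c) set) (\<lambda>_. {-M..M}))"
    by (intro finite_PiE) auto
qed

lemma coversI:
  assumes "q \<in> cells M" "even (p i)" "\<bar>q i - p i\<bar> = 1" "\<And>j. j \<noteq> i \<Longrightarrow> q j = p j"
  shows "q \<in> covers M p"
  using assms unfolding covers_def by blast

lemma coversE:
  assumes "q \<in> covers M p"
  obtains i where "q \<in> cells M" "even (p i)" "\<bar>q i - p i\<bar> = 1" "\<And>j. j \<noteq> i \<Longrightarrow> q j = p j"
  using assms unfolding covers_def by blast

lemma covers_subset: "covers M p \<subseteq> cells M"
  by (auto simp: covers_def)

lemma finite_covers [simp]: "finite (covers M (p :: 'r::finite \<times> 'c::finite \<Rightarrow> int))"
  by (rule finite_subset[OF covers_subset]) simp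

lemma covers_flip_iff: "q \<in> covers M (flip r p) \<longleftrightarrow> flip r q \<in> covers M p"
proof -
  have "even (flip r p i) \<longleftrightarrow> even (p i)" for i by (simp add: flip_def)
  moreover have "\<bar>q i - flip r p i\<bar> = \<bar>flip r q i - p i\<bar>" for i
    by (simp add: flip_def) linarith
  moreover have "q j = flip r p j \<longleftrightarrow> flip r q j = p j" for j by (auto simp: flip_def)
  ultimately show ?thesis by (simp add: covers_def)
qed

lemma sum_covers_flip: 
  "(\<Sum>q\<in>covers M (flip r p). f q) = (\<Sum>q\<in>covers M p. f (flip r q))"
  by (rule sum.reindex_bij_witness[of _ "flip r" "flip r"]) (auto simp: covers_flip_iff)

lemma cell_dim_covers:
  fixes p :: "'r::finite \<times> 'c::finite \<Rightarrow> int"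
  assumes "q \<in> covers M p" shows "cell_dim q = Suc (cell_dim p)"
proof -
  obtain i where i: "even (p i)" "\<bar>q i - p i\<bar> = 1" "\<And>j. j \<noteq> i \<Longrightarrow> q j = p j"
    using assms by (auto simp: covers_def)
  have "odd (q i)" using i(1,2) by presburger
  then have "{j. odd (q j)} = insert i {j. odd (p j)}" using i by (auto, metis)
  then show ?thesis using i(1) by (simp add: cell_dim_def)
qed

text \<open>Faces of a cell of the boundary complex are again in the boundary complex because \<open>M\<close> is even.\<close>

lemma face_in_cells:
  assumes "even M" "q \<in> cells M" "even (p i)" "\<bar>q i - p i\<bar> = 1" "\<And>j. j \<noteq> i \<Longrightarrow> q j = p j"
  shows "p \<in> cells M"
  unfolding cells_def
proof (intro CollectI allI conjI)
  fix r c
  have q: "\<bar>q (r, c)\<bar> \<le> M" using assms(2) by (auto simp: cells_def)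
  show "\<bar>p (r, c)\<bar> \<le> M"
  proof (cases "(r, c) = i")
    case True
    then show ?thesis using q assms(1,3,4) by presburger
  qed (use q assms(5) in auto)
next
  fix r
  obtain c where c: "\<bar>q (r, c)\<bar> = M" using assms(2) by (auto simp: cells_def)
  have "odd (q i)" using assms(3,4) by presburger
  then have "(r, c) \<noteq> i" using c assms(1) by auto
  then show "\<exists>c. \<bar>p (r, c)\<bar> = M" using c assms(5) by metis
qed

text \<open>The diamond property. If \<open>s\<close> lies two steps above \<open>p\<close>, the two
  moves concern different coordinates, since a moved coordinate becomes odd and cannot move again;
  the cells in between are obtained by doing either move first.\<close>

lemma even_card_between:
  fixes p :: "'r::finite \<times> 'c::finite \<Rightarrow> int"
  assumes "even M"
  shows "even (card {q \<in> covers M p. s \<in> covers M q})"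
proof (cases "{q \<in> covers M p. s \<in> covers M q} = {}")
  case False
  then obtain q where q: "q \<in> covers M p" "s \<in> covers M q" by auto
  obtain i where i: "even (p i)" "\<bar>q i - p i\<bar> = 1" "\<And>j. j \<noteq> i \<Longrightarrow> q j = p j"
    using q(1) by (auto simp: covers_def)
  obtain j where j: "even (q j)" "\<bar>s j - q j\<bar> = 1" "\<And>k. k \<noteq> j \<Longrightarrow> s k = q k"
    using q(2) by (auto simp: covers_def)
  have s: "s \<in> cells M" using q(2) by (auto simp: covers_def)
  have "odd (q i)" using i(1,2) by presburger
  then have ij: "i \<noteq> j" using j(1) by auto
  have oddj: "odd (s j)" using j(1,2) by presburger
  \<comment> \<open>The two moves in the other order; as a face of \<open>s\<close> this cell
    belongs to the complex.\<close>
  define q' where "q' = p(j := s j)"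
  have q'c: "q' \<in> cells M"
    by (rule face_in_cells[OF assms s, of _ i]) (use i j ij in \<open>auto simp: q'_def\<close>)
  have 1: "q' \<in> covers M p"
    by (rule coversI[OF q'c, of _ j]) (use i j ij in \<open>auto simp: q'_def\<close>)
  have 2: "s \<in> covers M q'"
    by (rule coversI[OF s, of _ i]) (use i j ij in \<open>auto simp: q'_def\<close>)
  have "q'' = q \<or> q'' = q'" if q'': "q'' \<in> covers M p" "s \<in> covers M q''" for q''
  proof -
    obtain k where k: "even (p k)" "\<bar>q'' k - p k\<bar> = 1" "\<And>j. j \<noteq> k \<Longrightarrow> q'' j = p j"
      using q''(1) by (auto simp: covers_def)
    obtain l where l: "even (q'' l)" "\<bar>s l - q'' l\<bar> = 1" "\<And>k. k \<noteq> l \<Longrightarrow> s k = q'' k"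
      using q''(2) by (auto simp: covers_def)
    have "odd (q'' k)" using k by presburger
    then have kl: "k \<noteq> l" using l(1) by auto
    have sk: "s k = q'' k" using l kl by auto
    have "s k \<noteq> p k" using sk k(2) by auto
    then have "k = i \<or> k = j" using i j by metis
    then show ?thesis
    proof
      assume "k = i"
      then have "q'' = q" using k(3) i(3) sk j(3) ij by (metis ext)
      then show ?thesis ..
    next
      assume "k = j"
      then have "q'' = q'" using k(3) sk by (auto simp: q'_def fun_eq_iff)
      then show ?thesis ..
    qed
  qed
  then have "{q \<in> covers M p. s \<in> covers M q} = {q, q'}" using q 1 2 by blast
  moreover have "q i \<noteq> q' i" using i ij by (auto simp: q'_def)
  then have "q \<noteq> q'" by auto
  ultimately show ?thesis by simp
next
  case True
  then show ?thesis by (metis card.empty even_zero)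
qed

text \<open>The endpoints move the only odd coordinate by one in either direction. This is the
  factor 2 gained when a boundary is summed over all vertices.\<close>

lemma card_faces_of_edge:
  fixes q :: "'r::finite \<times> 'c::finite \<Rightarrow> int"
  assumes "even M" "q \<in> cells M" "cell_dim q = 1"
  shows "card {p \<in> cells M. q \<in> covers M p} = 2"
proof -
  obtain i where i: "{i. odd (q i)} = {i}" using assms(3) by (auto simp: cell_dim_def card_1_singleton_iff)
  then have oi: "odd (q i)" by auto
  have *: "q(i := q i + e) \<in> {p \<in> cells M. q \<in> covers M p}" if "\<bar>e\<bar> = 1" for e
  proof -
    have ev: "even (q i + e)" using oi that by presburger
    have "q(i := q i + e) \<in> cells M"
      by (rule face_in_cells[OF assms(1,2), of _ i]) (use ev that in auto)
    moreover have "q \<in> covers M (q(i := q i + e))"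
      by (rule coversI[OF assms(2), of _ i]) (use ev that in auto)
    ultimately show ?thesis by simp
  qed
  have "p = q(i := q i + 1) \<or> p = q(i := q i - 1)" if p: "q \<in> covers M p" for p
  proof -
    obtain k where k: "even (p k)" "\<bar>q k - p k\<bar> = 1" "\<And>j. j \<noteq> k \<Longrightarrow> q j = p j"
      using p by (auto simp: covers_def)
    have "odd (q k)" using k by presburger
    then have [simp]: "k = i" using i by auto
    have "p k = q k + 1 \<or> p k = q k - 1" using k(2) by presburger
    then show ?thesis using k(3) by (auto simp: fun_eq_iff)
  qed
  then have "{p \<in> cells M. q \<in> covers M p} = {q(i := q i + 1), q(i := q i - 1)}"
    using *[of 1] *[of "-1"] by auto
  moreover have "q(i := q i + 1) \<noteq> q(i := q i - 1)" by (auto dest: fun_cong[of _ _ i])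
  ultimately show ?thesis by simp
qed

text \<open>The complex is a closed pseudomanifold. A ridge has R + 1 even coordinates and at least
  one in each of the R rows, so exactly one row has two, \<open>a\<close> and \<open>b\<close>, with
  \<open>a\<close> at absolute value \<open>M\<close>. If \<open>b\<close> is not at
  \<open>M\<close>, it can move both ways and \<open>a\<close> is stuck; at a corner each of the two
  can move inward only. Both cases give two covers.\<close>

lemma even_card_covers_of_ridge:
  fixes p :: "'r::finite \<times> 'c::finite \<Rightarrow> int"
  assumes M: "even M" "M > 0" and p: "p \<in> cells M"
    and rk: "Suc (cell_dim p) = CARD('r) * (CARD('c) - 1)"
  shows "even (card (covers M p))"
proof -
  define Ev where "Ev r = {c. even (p (r, c))}" for r
  have top: "\<exists>c\<in>Ev r. \<bar>p (r, c)\<bar> = M" for r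
    using p M by (fastforce simp: cells_def Ev_def)
  have pos: "card (Ev r) \<ge> 1" for r
    using top[of r] by (metis One_nat_def Suc_leI card_gt_0_iff empty_iff finite)
  have "{i. even (p i)} = (SIGMA r:UNIV. Ev r)" by (auto simp: Ev_def)
  then have "card {i. even (p i)} = (\<Sum>r\<in>UNIV. card (Ev r))" by simp
  moreover have "card {i. even (p i)} + cell_dim p = CARD('r \<times> 'c)"
  proof -
    have "{i. even (p i)} = - {i. odd (p i)}" by auto
    then show ?thesis unfolding cell_dim_def by (metis Compl_partition2 card_Un_disjoint finite Int_commute Compl_disjoint)
  qed
  ultimately have "(\<Sum>r\<in>UNIV. card (Ev r)) + CARD('r) * (CARD('c) - 1) = CARD('r) * CARD('c) + 1"
    using rk by (simp add: card_prod)
  moreover have "CARD('r) * (CARD('c) - 1) + CARD('r) = CARD('r) * CARD('c)"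
    by (metis Suc_diff_1 mult_Suc_right add.commute zero_less_card_finite)
  ultimately have "(\<Sum>r\<in>UNIV. card (Ev r)) = CARD('r) + 1" by linarith
  moreover have "(\<Sum>r\<in>UNIV. card (Ev r)) = (\<Sum>r\<in>UNIV. card (Ev r) - 1) + CARD('r)"
  proof -
    have "(\<Sum>r\<in>UNIV. card (Ev r)) = (\<Sum>r\<in>UNIV. (card (Ev r) - 1) + 1)"
      by (rule sum.cong) (use pos in \<open>auto simp del: One_nat_def\<close>)
    then show ?thesis by (simp only: sum.distrib) simp
  qed
  ultimately have "(\<Sum>r\<in>UNIV. card (Ev r) - 1) = 1" by linarith
  then obtain r where r: "card (Ev r) - 1 = 1" "\<And>r'. r' \<noteq> r \<Longrightarrow> card (Ev r') - 1 = 0"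
    using sum_eq_1_iff[of UNIV "\<lambda>r. card (Ev r) - 1"] by (metis UNIV_I finite)
  have r2: "card (Ev r) = 2" using r(1) by simp
  have r1: "card (Ev r') = 1" if "r' \<noteq> r" for r' using r(2)[OF that] pos[of r'] by simp
  obtain a where a: "a \<in> Ev r" "\<bar>p (r, a)\<bar> = M" using top by auto
  obtain b where b: "Ev r = {a, b}" "a \<noteq> b"
    using r2 a(1) by (metis card_2_iff insert_iff singletonD doubleton_eq_iff)
  have evb: "even (p (r, b))" and eva: "even (p (r, a))" using b by (auto simp: Ev_def)
  have bM: "\<bar>p (r, b)\<bar> \<le> M" using p by (auto simp: cells_def)
  have odd_ge: "odd (p (r,c))" if "c \<noteq> a" "c \<noteq> b" for c
    using that b(1) by (auto simp: Ev_def)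
  have pM: "\<bar>p (r', c)\<bar> \<le> M" "\<exists>c. \<bar>p (r', c)\<bar> = M" for r' c
    using p by (auto simp: cells_def)
  have upd: "p((r, x) := t) \<in> covers M p \<longleftrightarrow> \<bar>t\<bar> \<le> M \<and> \<bar>p (r, y)\<bar> = M"
    if "\<bar>t - p (r, x)\<bar> = 1" "x = a \<and> y = b \<or> x = b \<and> y = a" for x y t
  proof -
    have ex: "even (p (r, x))" using that evb eva by auto
    then have ot: "odd t" using that(1) by presburger
    have xy: "x \<noteq> y" using that b(2) by auto
    have c: "c = x \<or> c = y \<or> odd (p (r, c))" for c using odd_ge that by blast
    have "p((r, x) := t) \<in> cells M \<longleftrightarrow> \<bar>t\<bar> \<le> M \<and> \<bar>p (r, y)\<bar> = M"
    proof
      assume A: "p((r, x) := t) \<in> cells M"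
      then have "\<exists>c'. \<bar>(p((r, x) := t)) (r, c')\<bar> = M" unfolding cells_def by blast
      then obtain c' where c': "\<bar>(p((r, x) := t)) (r, c')\<bar> = M" ..
      have "\<bar>(p((r, x) := t)) (r, x)\<bar> \<le> M" using A unfolding cells_def by blast
      moreover have "c' \<noteq> x" using c' ot M(1) by (auto simp: )
      moreover have "c' = y" using c[of c'] c' M(1) \<open>c' \<noteq> x\<close> by auto
      ultimately show "\<bar>t\<bar> \<le> M \<and> \<bar>p (r, y)\<bar> = M" using c' by auto
    next
      assume "\<bar>t\<bar> \<le> M \<and> \<bar>p (r, y)\<bar> = M"
      then show "p((r, x) := t) \<in> cells M"
        unfolding cells_def using pM xy by (auto, metis)
    qed
    moreover have "p((r, x) := t) \<in> covers M p" if "p((r, x) := t) \<in> cells M"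
      by (rule coversI[OF that, of _ "(r, x)"]) (use ex \<open>\<bar>t - p (r, x)\<bar> = 1\<close> in auto)
    ultimately show ?thesis using covers_subset by blast
  qed
  have sub: "\<exists>x t. (x = a \<or> x = b) \<and> \<bar>t - p (r, x)\<bar> = 1 \<and> q = p((r, x) := t)" if q: "q \<in> covers M p" for q
  proof -
    obtain r' x where i: "even (p (r', x))" "\<bar>q (r', x) - p (r', x)\<bar> = 1" "\<And>j. j \<noteq> (r', x) \<Longrightarrow> q j = p j"
      using q by (auto simp: covers_def)
    have qx: "odd (q (r', x))" using i by presburger
    \<comment> \<open>In a row with a single even coordinate, that coordinate is the one at absolute
      value \<open>M\<close>; moving it would leave the cube boundary.\<close>
    have "r' = r"
    proof (rule ccontr)
      assume "r' \<noteq> r"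
      then obtain e where e: "Ev r' = {e}" using r1 by (metis card_1_singletonE)
      then have [simp]: "x = e" using i(1) by (auto simp: Ev_def)
      have "q \<in> cells M" using q covers_subset by blast
      then obtain c where c: "\<bar>q (r', c)\<bar> = M" unfolding cells_def by blast
      then have "c \<noteq> x" using qx M(1) by auto
      then have "c \<in> Ev r'" using c i(3)[of "(r', c)"] M(1) by (auto simp: Ev_def)
      then show False using e \<open>c \<noteq> x\<close> by auto
    qed
    moreover have "x = a \<or> x = b" using i(1) odd_ge calculation by blast
    moreover have "q = p((r, x) := q (r, x))" using i(3) calculation by (auto simp: fun_eq_iff)
    ultimately show ?thesis using i(2) by blast
  qed
  have neq: "p((r, b) := p (r, b) + 1) \<noteq> p((r, b) := p (r, b) - 1)"
    by (auto dest: fun_cong[of _ _ "(r, b)"])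
  show ?thesis
  proof (cases "\<bar>p (r, b)\<bar> = M")
    case False
    have "covers M p = {p((r, b) := p (r, b) + 1), p((r, b) := p (r, b) - 1)}" (is "_ = ?R")
    proof
      show "covers M p \<subseteq> ?R"
      proof
        fix q assume q: "q \<in> covers M p"
        then obtain x t where xt: "x = a \<or> x = b" "\<bar>t - p (r, x)\<bar> = 1" "q = p((r, x) := t)"
          using sub by blast
        have "x = b" using upd[OF xt(2), of b] xt q False by auto
        moreover then have "t = p (r, b) + 1 \<or> t = p (r, b) - 1" using xt(2) by presburger
        ultimately show "q \<in> ?R" using xt(3) by auto
      qed
      show "?R \<subseteq> covers M p" using upd[of _ b a] a(2) False bM by auto
    qed
    then show ?thesis using neq by simp
  next
    case True
    have in1: "\<exists>!t. \<bar>t - p (r, x)\<bar> = 1 \<and> \<bar>t\<bar> \<le> M" if "\<bar>p (r, x)\<bar> = M" for x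
      using that M(2) by (intro ex1I[of _ "p (r, x) - sgn (p (r, x))"]) (auto simp: sgn_if split: if_splits)
    obtain ta where ta: "\<bar>ta - p (r, a)\<bar> = 1" "\<bar>ta\<bar> \<le> M" "\<And>t. \<bar>t - p (r, a)\<bar> = 1 \<Longrightarrow> \<bar>t\<bar> \<le> M \<Longrightarrow> t = ta"
      using in1[OF a(2)] by blast
    obtain tb where tb: "\<bar>tb - p (r, b)\<bar> = 1" "\<bar>tb\<bar> \<le> M" "\<And>t. \<bar>t - p (r, b)\<bar> = 1 \<Longrightarrow> \<bar>t\<bar> \<le> M \<Longrightarrow> t = tb"
      using in1[OF True] by blast
    have "covers M p = {p((r, a) := ta), p((r, b) := tb)}" (is "_ = ?R")
    proof
      show "covers M p \<subseteq> ?R"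
      proof
        fix q assume q: "q \<in> covers M p"
        then obtain x t where xt: "x = a \<or> x = b" "\<bar>t - p (r, x)\<bar> = 1" "q = p((r, x) := t)"
          using sub by blast
        have "\<bar>t\<bar> \<le> M" using upd[OF xt(2), of "if x = a then b else a"] xt q by auto
        then show "q \<in> ?R" using xt ta(3) tb(3) by auto
      qed
      have "p((r, a) := ta) \<in> covers M p" using upd[OF ta(1), of b] ta(2) True by blast
      moreover have "p((r, b) := tb) \<in> covers M p" using upd[OF tb(1), of a] tb(2) a(2) by blast
      ultimately show "?R \<subseteq> covers M p" by blast
    qed
    moreover have "p((r, a) := ta) \<noteq> p((r, b) := tb)"
      using b(2) ta(1) by (auto dest: fun_cong[of _ _ "(r, a)"])
    ultimately show ?thesis by simp
  qed
qed

section \<open>Sign changes along chains of cells\<close>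

text \<open>Functions on cells are read as cellular chains, and this is their boundary operator.
  Orientation signs are omitted because only parities are used.\<close>

definition bd :: "int \<Rightarrow> (('r::finite \<times> 'c::finite \<Rightarrow> int) \<Rightarrow> int) \<Rightarrow> ('r \<times> 'c \<Rightarrow> int) \<Rightarrow> int" where
  "bd M \<phi> p = (\<Sum>q\<in>covers M p. \<phi> q)"

text \<open>The cap product of the chain \<phi> with the one-cochain on edges of the barycentric
  subdivision that records the changes of \<open>s\<close>.\<close>

definition jump ::
    "int \<Rightarrow> (('r::finite \<times> 'c::finite \<Rightarrow> int) \<Rightarrow> bool) \<Rightarrow> (('r \<times> 'c \<Rightarrow> int) \<Rightarrow> int) \<Rightarrow> ('r \<times> 'c \<Rightarrow> int) \<Rightarrow> int" where
  "jump M s \<phi> p = (\<Sum>q\<in>covers M p. of_bool (s p \<noteq> s q) * \<phi> q)"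

definition flip_invariant :: "int \<Rightarrow> (('r \<times> 'c \<Rightarrow> int) \<Rightarrow> 'b) \<Rightarrow> bool" where
  "flip_invariant M \<phi> \<longleftrightarrow> (\<forall>p\<in>cells M. \<forall>r. \<phi> (flip r p) = \<phi> p)"

text \<open>Whether \<open>s\<close> changes along an edge is invariant under all flips, so these
  changes form a one-cocycle on the quotient. It represents the sum over \<open>r\<close> in
  \<open>J\<close> of the degree one generators.\<close>

definition sign_section :: "int \<Rightarrow> 'r set \<Rightarrow> (('r \<times> 'c \<Rightarrow> int) \<Rightarrow> bool) \<Rightarrow> bool" where
  "sign_section M J s \<longleftrightarrow> (\<forall>p\<in>cells M. \<forall>r. s (flip r p) \<longleftrightarrow> (s p \<noteq> (r \<in> J)))"

definition vertices :: "int \<Rightarrow> ('r \<times> 'c \<Rightarrow> int) set" where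
  "vertices M = {p \<in> cells M. cell_dim p = 0}"

text \<open>The number of maximal chains of cells along which the section \<open>ss ! a\<close> changes at step \<open>a\<close>, for all \<open>a\<close>.
  Chains come in orbits of size \<open>2\<^sup>R\<close> under the flips of the \<open>R\<close> rows, so the parity of the number of orbits is
  the value of \<open>chain_sum\<close> modulo \<open>2\<^bsup>R+1\<^esup>\<close>.\<close>

definition chain_sum :: "int \<Rightarrow> (('r::finite \<times> 'c::finite \<Rightarrow> int) \<Rightarrow> bool) list \<Rightarrow> int" where
  "chain_sum M ss = (\<Sum>p\<in>vertices M. foldr (jump M) ss (\<lambda>_. 1) p)"

section \<open>Boundary and jump operators modulo 2\<close>

lemma covers_cells: "q \<in> covers M p \<Longrightarrow> q \<in> cells M"
  using covers_subset by blast

lemma bd_cong: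
  assumes "\<And>q. q \<in> covers M p \<Longrightarrow> [\<phi> q = \<psi> q] (mod 2)"
  shows "[bd M \<phi> p = bd M \<psi> p] (mod 2)"
  unfolding bd_def by (rule cong_sum) (rule assms)

lemma jump_cong:
  assumes "\<And>q. q \<in> covers M p \<Longrightarrow> [\<phi> q = \<psi> q] (mod 2)"
  shows "[jump M s \<phi> p = jump M s \<psi> p] (mod 2)"
  unfolding jump_def by (intro cong_sum cong_mult cong_refl assms)

lemma bd_bd:
  fixes p :: "'r::finite \<times> 'c::finite \<Rightarrow> int"
  assumes "even M"
  shows "[bd M (bd M \<phi>) p = 0] (mod 2)"
proof -
  have "bd M (bd M \<phi>) p = (\<Sum>q\<in>covers M p. \<Sum>s\<in>cells M. of_bool (s \<in> covers M q) * \<phi> s)"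
    unfolding bd_def
    by (intro sum.cong refl sum.mono_neutral_cong_left) (auto dest: covers_cells)
  also have "\<dots> = (\<Sum>s\<in>cells M. \<Sum>q\<in>covers M p. of_bool (s \<in> covers M q) * \<phi> s)"
    by (rule sum.swap)
  also have "\<dots> = (\<Sum>s\<in>cells M. int (card {q \<in> covers M p. s \<in> covers M q}) * \<phi> s)"
    by (simp add: flip: sum_distrib_right) (simp add: of_bool_def sum.If_cases Int_def)
  also have "[(\<Sum>s\<in>cells M. int (card {q \<in> covers M p. s \<in> covers M q}) * \<phi> s) = (\<Sum>s\<in>(cells M :: ('r \<times> 'c \<Rightarrow> int) set). 0)] (mod 2)"
    by (rule cong_sum) (simp add: cong_0_iff even_card_between[OF assms])
  finally show ?thesis by simp
qed

lemma of_bool_neq_cong: "[of_bool (a \<noteq> b) = of_bool a + of_bool b] (mod (2::int))"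
  by (cases a; cases b) (auto simp: cong_def)

text \<open>Modulo 2, \<open>jump M s\<close> is the commutator of \<^term>\<open>bd M\<close> with multiplication by \<open>s\<close>.\<close>

lemma jump_commutator:
  "[jump M s \<phi> p = of_bool (s p) * bd M \<phi> p + bd M (\<lambda>q. of_bool (s q) * \<phi> q) p] (mod 2)"
proof -
  have "[jump M s \<phi> p = (\<Sum>q\<in>covers M p. (of_bool (s p) + of_bool (s q)) * \<phi> q)] (mod 2)"
    unfolding jump_def by (intro cong_sum cong_mult cong_refl of_bool_neq_cong)
  then show ?thesis by (simp add: bd_def algebra_simps sum.distrib sum_distrib_left)
qed

text \<open>A commutator with \<open>bd\<close> commutes with \<open>bd\<close> modulo 2: since
  \<open>bd\<close> squares to zero, both sides reduce to the boundary of \<open>s\<close> times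
  \<open>bd M \<phi>\<close>.\<close>

lemma bd_jump:
  assumes "even M"
  shows "[bd M (jump M s \<phi>) p = jump M s (bd M \<phi>) p] (mod 2)"
proof -
  have "[bd M (jump M s \<phi>) p = bd M (\<lambda>q. of_bool (s q) * bd M \<phi> q + bd M (\<lambda>q. of_bool (s q) * \<phi> q) q) p] (mod 2)"
    by (intro bd_cong jump_commutator)
  also have "bd M (\<lambda>q. of_bool (s q) * bd M \<phi> q + bd M (\<lambda>q. of_bool (s q) * \<phi> q) q) p =
     bd M (\<lambda>q. of_bool (s q) * bd M \<phi> q) p + bd M (bd M (\<lambda>q. of_bool (s q) * \<phi> q)) p"
    by (simp add: bd_def sum.distrib)
  also have "[\<dots> = bd M (\<lambda>q. of_bool (s q) * bd M \<phi> q) p + 0] (mod 2)"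
    by (intro cong_add cong_refl bd_bd assms)
  finally have 1: "[bd M (jump M s \<phi>) p = bd M (\<lambda>q. of_bool (s q) * bd M \<phi> q) p] (mod 2)" by simp
  have "[jump M s (bd M \<phi>) p = of_bool (s p) * bd M (bd M \<phi>) p + bd M (\<lambda>q. of_bool (s q) * bd M \<phi> q) p] (mod 2)"
    by (rule jump_commutator)
  also have "[of_bool (s p) * bd M (bd M \<phi>) p + bd M (\<lambda>q. of_bool (s q) * bd M \<phi> q) p
     = of_bool (s p) * 0 + bd M (\<lambda>q. of_bool (s q) * bd M \<phi> q) p] (mod 2)"
    by (intro cong_add cong_refl cong_mult bd_bd assms)
  finally show ?thesis using 1 by (simp add: cong_def)
qed

text \<open>Each jump climbs one dimension, so agreement is required only in the dimension reached
  at the end. This restriction lets the pseudomanifold property, valid for ridges only, be used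
  below a list of jumps.\<close>

lemma foldr_jump_cong:
  assumes "\<And>q. q \<in> cells M \<Longrightarrow> cell_dim q = cell_dim p + length ss \<Longrightarrow> [\<phi> q = \<psi> q] (mod 2)" "p \<in> cells M"
  shows "[foldr (jump M) ss \<phi> p = foldr (jump M) ss \<psi> p] (mod 2)"
  using assms
proof (induction ss arbitrary: p)
  case (Cons s ss)
  show ?case unfolding foldr.simps o_def
    by (intro jump_cong Cons.IH Cons.prems(1)) (auto simp: cell_dim_covers dest: covers_cells)
qed auto

lemma foldr_jump_zero: "foldr (jump M) ss (\<lambda>_. 0) = (\<lambda>_. 0)"
  by (induction ss) (auto simp: jump_def)

lemma foldr_jump_add:
  "foldr (jump M) ss (\<lambda>q. \<phi> q + \<psi> q) p = foldr (jump M) ss \<phi> p + foldr (jump M) ss \<psi> p"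
  by (induction ss arbitrary: p) (auto simp: jump_def algebra_simps sum.distrib)

lemma foldr_jump_bd:
  assumes "even M" "p \<in> cells M"
  shows "[foldr (jump M) ss (bd M \<phi>) p = bd M (foldr (jump M) ss \<phi>) p] (mod 2)"
  using assms(2)
proof (induction ss arbitrary: p)
  case (Cons s ss)
  have "[jump M s (foldr (jump M) ss (bd M \<phi>)) p = jump M s (bd M (foldr (jump M) ss \<phi>)) p] (mod 2)"
    by (intro jump_cong Cons.IH) (auto dest: covers_cells)
  also have "[jump M s (bd M (foldr (jump M) ss \<phi>)) p = bd M (jump M s (foldr (jump M) ss \<phi>)) p] (mod 2)"
    by (rule cong_sym, rule bd_jump, rule assms)
  finally show ?case by simp
qed auto

text \<open>The boundary commutes past the jumps and then meets the constant chain 1, the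
  fundamental cycle, at a ridge.\<close>

lemma bd_foldr_jump_one:
  fixes p :: "'r::finite \<times> 'c::finite \<Rightarrow> int"
  assumes M: "even M" "M > 0" and p: "p \<in> cells M"
    and len: "Suc (cell_dim p + length ss) = CARD('r) * (CARD('c) - 1)"
  shows "[bd M (foldr (jump M) ss (\<lambda>_. 1)) p = 0] (mod 2)"
proof -
  have "[bd M (foldr (jump M) ss (\<lambda>_. 1)) p = foldr (jump M) ss (bd M (\<lambda>_. 1)) p] (mod 2)"
    by (rule cong_sym, rule foldr_jump_bd[OF M(1) p])
  also have "[foldr (jump M) ss (bd M (\<lambda>_. 1)) p = foldr (jump M) ss (\<lambda>_. 0) p] (mod 2)"
    by (intro foldr_jump_cong p) (use len in \<open>simp add: bd_def cong_0_iff even_card_covers_of_ridge[OF M]\<close>)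
  finally show ?thesis by (simp add: foldr_jump_zero)
qed

section \<open>Flip invariance and counting of orbits\<close>

lemma flip_invariant_bd: "flip_invariant M \<phi> \<Longrightarrow> flip_invariant M (bd M \<phi>)"
  by (auto simp: flip_invariant_def bd_def sum_covers_flip intro!: sum.cong dest: covers_cells)

lemma flip_invariant_jump:
  assumes "sign_section M J s" "flip_invariant M \<phi>" shows "flip_invariant M (jump M s \<phi>)"
  using assms
  by (auto simp: flip_invariant_def sign_section_def jump_def sum_covers_flip intro!: sum.cong dest: covers_cells)

lemma flip_invariant_foldr_jump:
  assumes "\<And>s. s \<in> set ss \<Longrightarrow> \<exists>J. sign_section M J s" "flip_invariant M \<phi>"
  shows "flip_invariant M (foldr (jump M) ss \<phi>)"
  using assms by (induction ss) (auto intro: flip_invariant_jump)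

text \<open>The fallback coordinate depends only on which coordinates vanish, so it does not change
  under flips. Preferring \<open>c0\<close> makes this coordinate alone decide whenever it is
  nonzero.\<close>

definition first_sign :: "'c \<Rightarrow> 'r \<Rightarrow> ('r \<times> 'c \<Rightarrow> int) \<Rightarrow> bool" where
  "first_sign c0 r p \<longleftrightarrow> p (r, if p (r, c0) \<noteq> 0 then c0 else SOME c. p (r, c) \<noteq> 0) < 0"

lemma sign_section_first_sign:
  assumes "M > 0" shows "sign_section M {r} (first_sign c0 r)"
  unfolding sign_section_def
proof (intro ballI allI)
  fix p :: "'a \<times> 'b \<Rightarrow> int" and r' assume p: "p \<in> cells M"
  have nz: "flip r' p i \<noteq> 0 \<longleftrightarrow> p i \<noteq> 0" for i by (simp add: flip_def)
  obtain c where "\<bar>p (r, c)\<bar> = M" using p by (auto simp: cells_def)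
  then have "p (r, c) \<noteq> 0" using assms by auto
  then have "p (r, SOME c. p (r, c) \<noteq> 0) \<noteq> 0" by (rule someI[of "\<lambda>c. p (r, c) \<noteq> 0"])
  then show "first_sign c0 r (flip r' p) = (first_sign c0 r p \<noteq> (r' \<in> {r}))"
    unfolding first_sign_def nz by (auto simp: flip_def)
qed

text \<open>Flipping row \<open>a\<close> exchanges the cells with and without sign \<open>a\<close>
  and preserves the signs of the other rows, so each row contributes one factor 2. With all rows in
  \<open>R\<close> the remaining cells represent the orbits.\<close>

lemma sum_flip_invariant_rows:
  fixes P :: "('r::finite \<times> 'c::finite \<Rightarrow> int) set"
  assumes P: "P \<subseteq> cells M" "\<And>p r. p \<in> P \<Longrightarrow> flip r p \<in> P"
    and s: "\<And>r. sign_section M {r} (s r)" and \<phi>: "flip_invariant M \<phi>"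
  shows "(\<Sum>p\<in>P. \<phi> p) = 2 ^ card R * (\<Sum>p\<in>{p\<in>P. \<forall>r\<in>R. \<not> s r p}. \<phi> p :: int)"
proof -
  have "finite R" by simp
  then show ?thesis
  proof induction
    case (insert a R)
    let ?A = "{p\<in>P. \<forall>r\<in>R. \<not> s r p}"
    have fin: "finite P" using finite_subset[OF P(1)] by simp
    have sf: "s r (flip r' p) \<longleftrightarrow> (s r p \<noteq> (r' = r))" if "p \<in> P" for r r' p
      using s[of r] that P(1) by (auto simp: sign_section_def)
    have "(\<Sum>p\<in>?A. \<phi> p) = (\<Sum>p\<in>{p\<in>?A. s a p}. \<phi> p) + (\<Sum>p\<in>{p\<in>?A. \<not> s a p}. \<phi> p)"
      using fin by (subst sum.union_disjoint[symmetric]) (auto intro: sum.cong)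
    also have "(\<Sum>p\<in>{p\<in>?A. s a p}. \<phi> p) = (\<Sum>p\<in>{p\<in>?A. \<not> s a p}. \<phi> p)"
    proof (rule sum.reindex_bij_witness[of _ "flip a" "flip a"])
      fix p assume "p \<in> {p\<in>?A. s a p}"
      then show "flip a p \<in> {p\<in>?A. \<not> s a p}" using P(2) insert(2) by (auto simp: sf)
      show "\<phi> (flip a p) = \<phi> p" using \<phi> P(1) \<open>p \<in> {p\<in>?A. s a p}\<close> by (auto simp: flip_invariant_def)
    next
      fix p assume "p \<in> {p\<in>?A. \<not> s a p}"
      then show "flip a p \<in> {p\<in>?A. s a p}" using P(2) insert(2) by (auto simp: sf)
    qed auto
    also have "{p\<in>?A. \<not> s a p} = {p\<in>P. \<forall>r\<in>insert a R. \<not> s r p}" by auto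
    finally show ?case using insert by simp
  qed simp
qed

lemma sum_flip_invariant_dvd:
  fixes P :: "('r::finite \<times> 'c::finite \<Rightarrow> int) set"
  assumes M: "M > 0" and P: "P \<subseteq> cells M" "\<And>p r. p \<in> P \<Longrightarrow> flip r p \<in> P"
    and \<phi>: "flip_invariant M \<phi>"
  shows "2 ^ CARD('r) dvd (\<Sum>p\<in>P. \<phi> p :: int)"
  using sum_flip_invariant_rows[OF P sign_section_first_sign[OF M] \<phi>, of UNIV undefined] by (simp del: UNIV_I)

text \<open>Half of the difference of the two functions is again integral and invariant, so its sum
  is divisible by one factor 2 per row. This raises pointwise congruences modulo 2 to the modulus
  needed for orbit parities.\<close>

lemma sum_flip_invariant_cong:
  fixes P :: "('r::finite \<times> 'c::finite \<Rightarrow> int) set"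
  assumes M: "M > 0" and P: "P \<subseteq> cells M" "\<And>p r. p \<in> P \<Longrightarrow> flip r p \<in> P"
    and \<phi>: "flip_invariant M \<phi>" "flip_invariant M \<psi>" and eq: "\<And>p. p \<in> P \<Longrightarrow> [\<phi> p = \<psi> p] (mod 2)"
  shows "[(\<Sum>p\<in>P. \<phi> p) = (\<Sum>p\<in>P. \<psi> p :: int)] (mod 2 ^ Suc (CARD('r)))"
proof -
  define \<delta> where "\<delta> p = (\<phi> p - \<psi> p) div 2" for p
  have "(\<Sum>p\<in>P. \<phi> p) - (\<Sum>p\<in>P. \<psi> p) = (\<Sum>p\<in>P. 2 * \<delta> p)"
    using eq by (auto simp: \<delta>_def cong_iff_dvd_diff sum_subtractf[symmetric] intro!: sum.cong)
  also have "\<dots> = 2 * (\<Sum>p\<in>P. \<delta> p)" by (simp add: sum_distrib_left)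
  finally have "(\<Sum>p\<in>P. \<phi> p) - (\<Sum>p\<in>P. \<psi> p) = 2 * (\<Sum>p\<in>P. \<delta> p)" .
  moreover have "2 ^ CARD('r) dvd (\<Sum>p\<in>P. \<delta> p)"
    by (rule sum_flip_invariant_dvd[OF M P]) (use \<phi> in \<open>auto simp: flip_invariant_def \<delta>_def\<close>)
  ultimately show ?thesis unfolding cong_iff_dvd_diff by (simp add: mult_dvd_mono)
qed

lemma vertices_flip: "p \<in> vertices M \<Longrightarrow> flip r p \<in> vertices M"
  by (simp add: vertices_def)

lemma vertices_subset: "vertices M \<subseteq> cells M"
  by (auto simp: vertices_def)

text \<open>Exchanging the sums counts every edge once for each of its two endpoints, and the
  invariant sum over edges supplies the other factors 2.\<close>

lemma sum_vertices_bd: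
  fixes \<phi> :: "('r::finite \<times> 'c::finite \<Rightarrow> int) \<Rightarrow> int"
  assumes M: "even M" "M > 0" and \<phi>: "flip_invariant M \<phi>"
  shows "[(\<Sum>p\<in>vertices M. bd M \<phi> p) = 0] (mod 2 ^ Suc (CARD('r)))"
proof -
  let ?E = "{q \<in> cells M. cell_dim q = 1}"
  have fv: "finite (vertices M :: ('r \<times> 'c \<Rightarrow> int) set)"
    by (rule finite_subset[OF vertices_subset]) simp
  have "(\<Sum>p\<in>vertices M. bd M \<phi> p) = (\<Sum>p\<in>vertices M. \<Sum>q\<in>?E. of_bool (q \<in> covers M p) * \<phi> q)"
    unfolding bd_def
    by (intro sum.cong refl sum.mono_neutral_cong_left) (auto simp: vertices_def cell_dim_covers dest: covers_cells)
  also have "\<dots> = (\<Sum>q\<in>?E. \<Sum>p\<in>vertices M. of_bool (q \<in> covers M p) * \<phi> q)"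
    by (rule sum.swap)
  also have "\<dots> = (\<Sum>q\<in>?E. int (card {p \<in> vertices M. q \<in> covers M p}) * \<phi> q)"
    using fv by (simp add: flip: sum_distrib_right) (simp add: of_bool_def sum.If_cases Int_def)
  also have "\<dots> = (\<Sum>q\<in>?E. 2 * \<phi> q)"
  proof (rule sum.cong[OF refl])
    fix q :: "'r \<times> 'c \<Rightarrow> int" assume q: "q \<in> ?E"
    then have "{p \<in> vertices M. q \<in> covers M p} = {p \<in> cells M. q \<in> covers M p}"
      using cell_dim_covers[of q M] by (auto simp: vertices_def)
    then show "int (card {p \<in> vertices M. q \<in> covers M p}) * \<phi> q = 2 * \<phi> q"
      using card_faces_of_edge[OF M(1), of q] q by simp
  qed
  also have "\<dots> = 2 * (\<Sum>q\<in>?E. \<phi> q)" by (simp add: sum_distrib_left)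
  finally have "(\<Sum>p\<in>vertices M. bd M \<phi> p) = 2 * (\<Sum>q\<in>?E. \<phi> q)" .
  moreover have "2 ^ CARD('r) dvd (\<Sum>q\<in>?E. \<phi> q)"
    by (rule sum_flip_invariant_dvd[OF M(2)]) (use \<phi> in auto)
  ultimately show ?thesis by (simp add: cong_0_iff mult_dvd_mono)
qed

section \<open>Multilinearity of chain sums in the sections\<close>

lemma chain_sum_add:
  fixes s :: "('r::finite \<times> 'c::finite \<Rightarrow> int) \<Rightarrow> bool"
  assumes M: "M > 0" and sec: "\<And>s. s \<in> set us \<union> set vs \<Longrightarrow> \<exists>J. sign_section M J s"
    "sign_section M J s" "sign_section M J' s'" "sign_section M J'' s''"
    and s: "\<And>p. p \<in> cells M \<Longrightarrow> s p \<longleftrightarrow> (s' p \<noteq> s'' p)"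
  shows "[chain_sum M (us @ s # vs) = chain_sum M (us @ s' # vs) + chain_sum M (us @ s'' # vs)]
    (mod 2 ^ Suc (CARD('r)))"
proof -
  let ?F = "foldr (jump M) us" let ?\<phi> = "foldr (jump M) vs (\<lambda>_. 1)"
  have \<phi>: "flip_invariant M ?\<phi>"
    by (rule flip_invariant_foldr_jump) (use sec in \<open>auto simp: flip_invariant_def\<close>)
  have inv: "flip_invariant M (?F (jump M t ?\<phi>))" if "sign_section M K t" for K t
    by (intro flip_invariant_foldr_jump flip_invariant_jump[OF that] \<phi>) (use sec in auto)
  have eq: "[?F (jump M s ?\<phi>) p = ?F (jump M s' ?\<phi>) p + ?F (jump M s'' ?\<phi>) p] (mod 2)" if p: "p \<in> cells M" for p
  proof -
    have "[?F (jump M s ?\<phi>) p = ?F (\<lambda>q. jump M s' ?\<phi> q + jump M s'' ?\<phi> q) p] (mod 2)"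
    proof (rule foldr_jump_cong[OF _ p])
      fix q :: "'r \<times> 'c \<Rightarrow> int" assume q: "q \<in> cells M"
      \<comment> \<open>An exclusive or changes along an edge exactly when one but not both of its
        arguments do, so the cocycles add modulo 2.\<close>
      have "[jump M s ?\<phi> q = (\<Sum>x\<in>covers M q. (of_bool (s' q \<noteq> s' x) + of_bool (s'' q \<noteq> s'' x)) * ?\<phi> x)] (mod 2)"
        unfolding jump_def
      proof (intro cong_sum cong_mult cong_refl)
        fix x assume "x \<in> covers M q"
        then show "[of_bool (s q \<noteq> s x) = of_bool (s' q \<noteq> s' x) + of_bool (s'' q \<noteq> s'' x)] (mod (2::int))"
          using s[OF q] s[of x] by (auto simp: cong_def dest: covers_cells)
      qed
      then show "[jump M s ?\<phi> q = jump M s' ?\<phi> q + jump M s'' ?\<phi> q] (mod 2)"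
        by (simp add: jump_def algebra_simps sum.distrib)
    qed
    then show ?thesis by (simp add: foldr_jump_add)
  qed
  have "[(\<Sum>p\<in>vertices M. ?F (jump M s ?\<phi>) p) = (\<Sum>p\<in>vertices M. ?F (jump M s' ?\<phi>) p + ?F (jump M s'' ?\<phi>) p)]
    (mod 2 ^ Suc (CARD('r)))"
  proof (rule sum_flip_invariant_cong[OF M vertices_subset vertices_flip])
    show "flip_invariant M (\<lambda>p. ?F (jump M s' ?\<phi>) p + ?F (jump M s'' ?\<phi>) p)"
      using inv[OF sec(3)] inv[OF sec(4)] by (simp add: flip_invariant_def)
  qed (use inv[OF sec(2)] eq vertices_subset in auto)
  then show ?thesis by (simp add: chain_sum_def sum.distrib)
qed

text \<open>An invariant section has a coboundary as its cocycle. By the commutator formula its jump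
  is the boundary of an invariant chain plus \<open>s\<close> times a boundary that vanishes in the
  dimension at hand; the outer jumps commute with \<open>bd\<close>, and a boundary has total zero.
  The length condition makes the dimensions match.\<close>

lemma chain_sum_invariant_section:
  fixes s :: "('r::finite \<times> 'c::finite \<Rightarrow> int) \<Rightarrow> bool"
  assumes M: "even M" "M > 0" and sec: "\<And>s. s \<in> set us \<union> set vs \<Longrightarrow> \<exists>J. sign_section M J s"
    "sign_section M {} s"
    and len: "Suc (length us + length vs) = CARD('r) * (CARD('c) - 1)"
  shows "[chain_sum M (us @ s # vs) = 0] (mod 2 ^ Suc (CARD('r)))"
proof -
  let ?F = "foldr (jump M) us" let ?\<phi> = "foldr (jump M) vs (\<lambda>_. 1)"
  let ?\<psi> = "\<lambda>q. of_bool (s q) * ?\<phi> q"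
  have \<phi>: "flip_invariant M ?\<phi>"
    by (rule flip_invariant_foldr_jump) (use sec in \<open>auto simp: flip_invariant_def\<close>)
  have s\<phi>: "flip_invariant M ?\<psi>"
    using \<phi> sec(2) by (auto simp: flip_invariant_def sign_section_def)
  have F\<psi>: "flip_invariant M (?F ?\<psi>)"
    by (rule flip_invariant_foldr_jump[OF _ s\<phi>]) (use sec in auto)
  have "[?F (jump M s ?\<phi>) p = bd M (?F ?\<psi>) p] (mod 2)" if p: "p \<in> vertices M" for p
  proof -
    have pc: "p \<in> cells M" "cell_dim p = 0" using p by (auto simp: vertices_def)
    have "[?F (jump M s ?\<phi>) p = ?F (bd M ?\<psi>) p] (mod 2)"
    proof (rule foldr_jump_cong[OF _ pc(1)])
      fix q :: "'r \<times> 'c \<Rightarrow> int" assume q: "q \<in> cells M" "cell_dim q = cell_dim p + length us"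
      have "[jump M s ?\<phi> q = of_bool (s q) * bd M ?\<phi> q + bd M ?\<psi> q] (mod 2)"
        by (rule jump_commutator)
      also have "[of_bool (s q) * bd M ?\<phi> q + bd M ?\<psi> q = of_bool (s q) * 0 + bd M ?\<psi> q] (mod 2)"
        by (intro cong_add cong_mult cong_refl bd_foldr_jump_one M q) (use q pc len in auto)
      finally show "[jump M s ?\<phi> q = bd M ?\<psi> q] (mod 2)" by simp
    qed
    also have "[?F (bd M ?\<psi>) p = bd M (?F ?\<psi>) p] (mod 2)"
      by (rule foldr_jump_bd[OF M(1) pc(1)])
    finally show ?thesis .
  qed
  then have "[(\<Sum>p\<in>vertices M. ?F (jump M s ?\<phi>) p) = (\<Sum>p\<in>vertices M. bd M (?F ?\<psi>) p)] (mod 2 ^ Suc (CARD('r)))"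
    by (intro sum_flip_invariant_cong[OF M(2) vertices_subset vertices_flip] flip_invariant_bd F\<psi>
          flip_invariant_foldr_jump[of us] flip_invariant_jump[OF sec(2)] \<phi>) (use sec in auto)
  also have "[(\<Sum>p\<in>vertices M. bd M (?F ?\<psi>) p) = 0] (mod 2 ^ Suc (CARD('r)))"
    by (rule sum_vertices_bd[OF M F\<psi>])
  finally show ?thesis by (simp add: chain_sum_def)
qed

text \<open>Only the set \<open>J\<close> of a section matters. Taking the exclusive or with
  \<open>b r\<close> removes \<open>r\<close> from \<open>J\<close>, and the invariant section that
  remains at the end contributes nothing.\<close>

lemma chain_sum_section_expand:
  fixes s :: "('r::finite \<times> 'c::finite \<Rightarrow> int) \<Rightarrow> bool"
  assumes M: "even M" "M > 0" and sec: "\<And>s. s \<in> set us \<union> set vs \<Longrightarrow> \<exists>J. sign_section M J s"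
    and b: "\<And>r. sign_section M {r} (b r)"
    and len: "Suc (length us + length vs) = CARD('r) * (CARD('c) - 1)"
    and s: "sign_section M J s"
  shows "[chain_sum M (us @ s # vs) = (\<Sum>r\<in>J. chain_sum M (us @ b r # vs))] (mod 2 ^ Suc (CARD('r)))"
proof -
  have "finite J" by simp
  then show ?thesis using s
  proof (induction J arbitrary: s)
    case empty
    then show ?case using chain_sum_invariant_section[OF M sec _ len] by simp
  next
    case (insert r J)
    define t where "t p \<longleftrightarrow> (s p \<noteq> b r p)" for p
    have t: "sign_section M J t"
      using insert.prems b[of r] insert.hyps unfolding sign_section_def t_def by auto
    have "[chain_sum M (us @ s # vs) = chain_sum M (us @ b r # vs) + chain_sum M (us @ t # vs)] (mod 2 ^ Suc (CARD('r)))"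
      by (rule chain_sum_add[OF M(2) sec insert.prems b t]) (auto simp: t_def)
    also have "[chain_sum M (us @ b r # vs) + chain_sum M (us @ t # vs) =
        chain_sum M (us @ b r # vs) + (\<Sum>r\<in>J. chain_sum M (us @ b r # vs))] (mod 2 ^ Suc (CARD('r)))"
      by (intro cong_add cong_refl insert.IH t)
    finally show ?case using insert.hyps by simp
  qed
qed

text \<open>Expansion of a product of linear forms: an element of \<open>listset Js\<close> picks
  one row from each factor, hence one monomial. Expanded factors are collected in \<open>us\<close>
  to keep the induction going.\<close>

lemma chain_sum_expand:
  fixes ss :: "(('r::finite \<times> 'c::finite \<Rightarrow> int) \<Rightarrow> bool) list"
  assumes M: "even M" "M > 0" and us: "\<And>s. s \<in> set us \<Longrightarrow> \<exists>J. sign_section M J s"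
    and b: "\<And>r. sign_section M {r} (b r)"
    and len: "length us + length ss = CARD('r) * (CARD('c) - 1)"
    and ss: "list_all2 (sign_section M) Js ss"
  shows "[chain_sum M (us @ ss) = (\<Sum>w\<in>listset Js. chain_sum M (us @ map b w))] (mod 2 ^ Suc (CARD('r)))"
  using ss us len
proof (induction Js ss arbitrary: us)
  case (Cons J Js s ss)
  have vs: "\<exists>J. sign_section M J s" if "s \<in> set ss" for s
    using Cons.hyps(2) that by (metis in_set_conv_nth list_all2_conv_all_nth)
  have "[chain_sum M (us @ s # ss) = (\<Sum>r\<in>J. chain_sum M (us @ b r # ss))] (mod 2 ^ Suc (CARD('r)))"
    by (rule chain_sum_section_expand[OF M _ b _ Cons.hyps(1)]) (use vs Cons.prems in auto)
  also have "[(\<Sum>r\<in>J. chain_sum M (us @ b r # ss)) =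
      (\<Sum>r\<in>J. \<Sum>w\<in>listset Js. chain_sum M (us @ b r # map b w))] (mod 2 ^ Suc (CARD('r)))"
  proof (rule cong_sum)
    fix r
    have "[chain_sum M ((us @ [b r]) @ ss) = (\<Sum>w\<in>listset Js. chain_sum M ((us @ [b r]) @ map b w))] (mod 2 ^ Suc (CARD('r)))"
      by (rule Cons.IH) (use Cons.prems b in auto)
    then show "[chain_sum M (us @ b r # ss) = (\<Sum>w\<in>listset Js. chain_sum M (us @ b r # map b w))] (mod 2 ^ Suc (CARD('r)))"
      by simp
  qed
  also have "(\<Sum>r\<in>J. \<Sum>w\<in>listset Js. chain_sum M (us @ b r # map b w)) =
     (\<Sum>w\<in>listset (J # Js). chain_sum M (us @ map b w))"
    unfolding sum.cartesian_product
    by (rule sum.reindex_bij_witness[of _ "\<lambda>w. (hd w, tl w)" "\<lambda>(r, w). r # w"]) (auto simp: set_Cons_def)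
  finally show ?case .
qed simp

section \<open>Evaluation of monomials\<close>

lemma ex_chain:
  fixes p :: "'r::finite \<times> 'c::finite \<Rightarrow> int"
  assumes "foldr (jump M) ss (\<lambda>_. 1) p \<noteq> 0"
  shows "\<exists>P. P 0 = p \<and> (\<forall>a<length ss. P (Suc a) \<in> covers M (P a) \<and> (ss ! a) (P a) \<noteq> (ss ! a) (P (Suc a)))"
  using assms
proof (induction ss arbitrary: p)
  case Nil
  then show ?case by auto
next
  case (Cons s ss)
  have "(\<Sum>q\<in>covers M p. of_bool (s p \<noteq> s q) * foldr (jump M) ss (\<lambda>_. 1) q) \<noteq> 0"
    using Cons.prems by (simp only: foldr.simps o_def jump_def[of M s] not_False_eq_True)
  then obtain q where "q \<in> covers M p" "of_bool (s p \<noteq> s q) * foldr (jump M) ss (\<lambda>_. 1) q \<noteq> 0"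
    by (rule sum.not_neutral_contains_not_neutral)
  then have q: "q \<in> covers M p" "s p \<noteq> s q" "foldr (jump M) ss (\<lambda>_. 1) q \<noteq> 0"
    by (auto simp only: mult_eq_0_iff of_bool_eq_0_iff)
  obtain P where P: "P 0 = q" "\<forall>a<length ss. P (Suc a) \<in> covers M (P a) \<and> (ss ! a) (P a) \<noteq> (ss ! a) (P (Suc a))"
    using Cons.IH[OF q(3)] by blast
  show ?case
    by (rule exI[of _ "case_nat p P"]) (use P q in \<open>auto simp: less_Suc_eq_0_disj\<close>)
qed

text \<open>A coordinate moves only while even and is odd afterwards, so along a chain it moves at
  most once and by at most one.\<close>

lemma chain_coordinate:
  assumes "\<And>a. a < n \<Longrightarrow> P (Suc a) \<in> covers M (P a)" "a \<le> b" "b \<le> n"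
  shows "P b i = P a i \<or> even (P a i) \<and> odd (P b i) \<and> \<bar>P b i - P a i\<bar> = 1"
  using assms(2,3)
proof (induction b rule: dec_induct)
  case (step b)
  have "P (Suc b) \<in> covers M (P b)" using step assms(1) by auto
  then obtain k where k: "even (P b k)" "\<bar>P (Suc b) k - P b k\<bar> = 1" "\<And>j. j \<noteq> k \<Longrightarrow> P (Suc b) j = P b j"
    by (rule coversE) blast
  show ?case
  proof (cases "i = k")
    case True
    have "odd (P (Suc b) k)" using k by presburger
    then show ?thesis using step k True by auto
  qed (use k step in auto)
qed simp

text \<open>For every \<open>c\<close> this represents the same degree one generator of row
  \<open>r\<close>, with the sign change placed where coordinate \<open>c\<close> crosses zero.
  Different coordinates for repeated factors play the role of transversality.\<close>

definition coordinate_sign :: "'c \<Rightarrow> 'c \<Rightarrow> 'r \<Rightarrow> ('r \<times> 'c \<Rightarrow> int) \<Rightarrow> bool" where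
  "coordinate_sign c0 c r p \<longleftrightarrow> (if p (r, c) \<noteq> 0 then p (r, c) < 0 else first_sign c0 r p)"

lemma sign_section_coordinate_sign:
  fixes c :: 'c and r :: 'r
  assumes "M > 0" shows "sign_section M {r} (coordinate_sign c0 c r)"
  unfolding sign_section_def
proof (intro ballI allI)
  fix p :: "'r \<times> 'c \<Rightarrow> int" and r' assume p: "p \<in> cells M"
  have "first_sign c0 r (flip r' p) = (first_sign c0 r p \<noteq> (r' \<in> {r}))"
    using sign_section_first_sign[OF assms, of r c0] p unfolding sign_section_def by blast
  then show "coordinate_sign c0 c r (flip r' p) = (coordinate_sign c0 c r p \<noteq> (r' \<in> {r}))"
    by (auto simp: coordinate_sign_def flip_def)
qed

text \<open>A coordinate of absolute value \<open>M\<close> in the last cell of a chain never changes, so a chain cannot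
  change the sign of that coordinate.\<close>

lemma chain_fixed_coordinate:
  fixes P :: "nat \<Rightarrow> 'r::finite \<times> 'c::finite \<Rightarrow> int"
  assumes M: "even M" "M > 0" and P0: "P 0 \<in> cells M"
    and P: "\<And>a. a < n \<Longrightarrow> P (Suc a) \<in> covers M (P a)"
    and chg: "\<And>a. a < n \<Longrightarrow> coordinate_sign c0 (k a) (w a) (P a) \<noteq> coordinate_sign c0 (k a) (w a) (P (Suc a))"
  obtains c where "\<And>a. a \<le> n \<Longrightarrow> P a (r, c) = P 0 (r, c)" "\<bar>P 0 (r, c)\<bar> = M"
    "\<And>a. a < n \<Longrightarrow> w a = r \<Longrightarrow> k a \<noteq> c"
proof -
  have "P n \<in> cells M" using P0 P by (cases n) (auto dest: covers_cells)
  then obtain c where c: "\<bar>P n (r, c)\<bar> = M" by (auto simp: cells_def)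
  then have ev: "even (P n (r, c))" using M(1) by auto
  have eq: "P a (r, c) = P n (r, c)" if "a \<le> n" for a
    using chain_coordinate[of n P M a n "(r, c)", OF P that] ev by auto
  show ?thesis
  proof
    show "P a (r, c) = P 0 (r, c)" if "a \<le> n" for a using eq[OF that] eq[of 0] by simp
    show "\<bar>P 0 (r, c)\<bar> = M" using eq[of 0] c by simp
    show "k a \<noteq> c" if "a < n" "w a = r" for a
      using chg[OF that(1)] that eq[of a] eq[of "Suc a"] c M(2) by (auto simp: coordinate_sign_def)
  qed
qed

lemma coordinate_sign_normalised:
  assumes "p (r, c0) > 0" shows "coordinate_sign c0 c r p \<longleftrightarrow> p (r, c) < 0"
  using assms by (auto simp: coordinate_sign_def first_sign_def)

text \<open>A power of a generator exceeding the dimension of its sphere vanishes: a contributing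
  chain would cross zero in all coordinates of row \<open>r\<close>, but the one at absolute value
  \<open>M\<close> never moves.\<close>

lemma chain_sum_coordinates_zero:
  fixes c0 :: "'c::finite" and w :: "nat \<Rightarrow> 'r::finite"
  assumes M: "even M" "M > 0" and r: "\<And>c. \<exists>a<n. w a = r \<and> k a = c"
  shows "chain_sum M (map (\<lambda>a. coordinate_sign c0 (k a) (w a)) [0..<n]) = 0"
  unfolding chain_sum_def
proof (rule sum.neutral, rule ballI, rule ccontr)
  fix p :: "'r \<times> 'c \<Rightarrow> int"
  assume p: "p \<in> vertices M" and "foldr (jump M) (map (\<lambda>a. coordinate_sign c0 (k a) (w a)) [0..<n]) (\<lambda>_. 1) p \<noteq> 0"
  from ex_chain[OF this(2)] obtain P where P: "P 0 = p" "\<And>a. a < n \<Longrightarrow> P (Suc a) \<in> covers M (P a)"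
    "\<And>a. a < n \<Longrightarrow> coordinate_sign c0 (k a) (w a) (P a) \<noteq> coordinate_sign c0 (k a) (w a) (P (Suc a))"
    by auto
  have "P 0 \<in> cells M" using p P(1) vertices_subset by auto
  from chain_fixed_coordinate[OF M this P(2,3), where r = r] obtain c where
    "\<And>a. a < n \<Longrightarrow> w a = r \<Longrightarrow> k a \<noteq> c" by metis
  then show False using r by blast
qed

text \<open>The coordinate hyperplanes other than \<open>c0\<close> meet in one orbit of points.
  Normalised to positive signs, the only contributing chain starts at \<open>M\<close> in the
  coordinates \<open>c0\<close> and zero elsewhere and lowers the other coordinates to -1 in the
  prescribed order.\<close>

lemma chain_sum_coordinates_one:
  fixes c0 :: "'c::finite" and w :: "nat \<Rightarrow> 'r::finite"
  assumes M: "even M" "M > 0"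
    and surj: "\<And>r c. c \<noteq> c0 \<Longrightarrow> \<exists>a<n. w a = r \<and> k a = c"
    and inj: "\<And>a b. a < n \<Longrightarrow> b < n \<Longrightarrow> w a = w b \<Longrightarrow> k a = k b \<Longrightarrow> a = b"
    and c0: "\<And>a. a < n \<Longrightarrow> k a \<noteq> c0"
  shows "chain_sum M (map (\<lambda>a. coordinate_sign c0 (k a) (w a)) [0..<n]) = 2 ^ CARD('r)"
proof -
  define s where "s a = coordinate_sign c0 (k a) (w a)" for a
  let ?ss = "map s [0..<n]"
  have M2: "M \<ge> 2" using M by presburger
  \<comment> \<open>The cells of this chain. The move is to -1, as zero is counted as nonnegative
    when coordinate \<open>c0\<close> is positive.\<close>
  define Z where "Z a = (\<lambda>(r, c). if c = c0 then M else if \<exists>b<a. w b = r \<and> k b = c then -1 else (0::int))" for a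
  have Zc: "Z a \<in> cells M" for a
    using M2 by (auto simp: cells_def Z_def)
  have Z0: "Z 0 \<in> vertices M"
    unfolding vertices_def cell_dim_def using Zc[of 0] M(1) by (auto simp: Z_def)
  have step: "jump M (s a) \<phi> (Z a) = \<phi> (Z (Suc a))" if a: "a < n" for a \<phi>
  proof -
    have new: "\<not> (\<exists>b<a. w b = w a \<and> k b = k a)"
      using inj[OF _ a] a by (metis less_irrefl less_trans)
    have sZ: "\<not> s a (Z a)"
      using c0[OF a] new M(2)
      by (auto simp: s_def coordinate_sign_normalised Z_def)
    have Zs: "Z (Suc a) j = Z a j" if j: "j \<noteq> (w a, k a)" for j
    proof -
      obtain r c where rc: "j = (r, c)" by (cases j)
      have "(\<exists>b<Suc a. w b = r \<and> k b = c) \<longleftrightarrow> (\<exists>b<a. w b = r \<and> k b = c)"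
        using j rc less_Suc_eq by auto
      then show ?thesis by (simp add: Z_def rc)
    qed
    have cov: "Z (Suc a) \<in> covers M (Z a)"
      by (rule coversI[OF Zc, of _ "(w a, k a)"]) (use c0[OF a] new Zs in \<open>auto simp: Z_def\<close>)
    have sZ': "s a (Z (Suc a))"
      using c0[OF a] M(2) by (auto simp: s_def coordinate_sign_normalised Z_def)
    have uniq: "q = Z (Suc a)" if q: "q \<in> covers M (Z a)" "s a q" for q
    proof -
      obtain i where i: "q \<in> cells M" "even (Z a i)" "\<bar>q i - Z a i\<bar> = 1" "\<And>j. j \<noteq> i \<Longrightarrow> q j = Z a j"
        using q(1) by (rule coversE) blast
      obtain r c where rc: "i = (r, c)" by (cases i)
      \<comment> \<open>Coordinate \<open>c0\<close> is the only one of its row at absolute value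
        \<open>M\<close>, since the others are at most 1 and \<open>M\<close> is at least 2; moving
        it would leave the boundary.\<close>
      have "c \<noteq> c0"
      proof
        assume "c = c0"
        obtain c' where c': "\<bar>q (r, c')\<bar> = M" using i(1) by (auto simp: cells_def)
        show False
        proof (cases "c' = c0")
          case True
          then show False using i(3) c' rc \<open>c = c0\<close> M2 by (auto simp: Z_def)
        next
          case False
          then have "\<bar>Z a (r, c')\<bar> = M" using i(4)[of "(r, c')"] c' rc \<open>c = c0\<close> by auto
          then show False using False M2 by (auto simp: Z_def split: if_splits)
        qed
      qed
      have qc0: "q (r', c0) = M" for r' using i(4)[of "(r', c0)"] rc \<open>c \<noteq> c0\<close> by (auto simp: Z_def)
      have "q (w a, k a) < 0"
        using q(2) M(2) by (simp add: s_def coordinate_sign_normalised qc0)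
      moreover have Za: "Z a (w a, k a) = 0" using new c0[OF a] by (auto simp: Z_def)
      ultimately have ia: "i = (w a, k a)" using i(4)[of "(w a, k a)"] by auto
      have "q i = -1" using i(3) Za ia \<open>q (w a, k a) < 0\<close> by auto
      show ?thesis
      proof
        fix j
        show "q j = Z (Suc a) j"
        proof (cases "j = i")
          case True
          then show ?thesis using \<open>q i = -1\<close> ia c0[OF a] by (auto simp: Z_def)
        next
          case False
          then have "q j = Z a j" using i(4) by auto
          also have "\<dots> = Z (Suc a) j" using Zs False ia by simp
          finally show ?thesis .
        qed
      qed
    qed
    have "jump M (s a) \<phi> (Z a) = (\<Sum>q\<in>{Z (Suc a)}. of_bool (s a (Z a) \<noteq> s a q) * \<phi> q)"
      unfolding jump_def by (rule sum.mono_neutral_right) (use cov uniq sZ in auto)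
    then show ?thesis using sZ sZ' by simp
  qed
  have one: "foldr (jump M) (map s [a..<n]) (\<lambda>_. 1) (Z a) = 1" if "a \<le> n" for a
    using that
  proof (induction a rule: inc_induct)
    case (step a)
    then show ?case by (simp add: upt_conv_Cons \<open>\<And>a \<phi>. a < n \<Longrightarrow> jump M (s a) \<phi> (Z a) = \<phi> (Z (Suc a))\<close>)
  qed simp
  have zero: "p = Z 0" if p: "p \<in> vertices M" "\<And>r. \<not> first_sign c0 r p" "foldr (jump M) ?ss (\<lambda>_. 1) p \<noteq> 0" for p
  proof -
    from ex_chain[OF p(3)] obtain P where P: "P 0 = p" "\<And>a. a < n \<Longrightarrow> P (Suc a) \<in> covers M (P a)"
      "\<And>a. a < n \<Longrightarrow> s a (P a) \<noteq> s a (P (Suc a))"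
      by auto
    have P0: "P 0 \<in> cells M" using p P(1) vertices_subset by auto
    have PM: "P a (r, c0) = M" if "a \<le> n" for a r
    proof -
      from chain_fixed_coordinate[OF M P0 P(2) P(3)[unfolded s_def], where r = r]
      obtain c where c: "\<And>a. a \<le> n \<Longrightarrow> P a (r, c) = P 0 (r, c)" "\<bar>P 0 (r, c)\<bar> = M"
        "\<And>a. a < n \<Longrightarrow> w a = r \<Longrightarrow> k a \<noteq> c" by metis
      have "c = c0" using c(3) surj by blast
      then have "P 0 (r, c0) = M" using c(2) p(2)[of r] P(1) M(2) by (auto simp: first_sign_def split: if_splits)
      then show ?thesis using c(1)[OF that] \<open>c = c0\<close> by simp
    qed
    show ?thesis
    proof
      fix i :: "'r \<times> 'c"
      obtain r c where rc: "i = (r, c)" by (cases i)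
      show "p i = Z 0 i"
      proof (cases "c = c0")
        case True
        then show ?thesis using PM[of 0 r] P(1) rc by (simp add: Z_def)
      next
        case False
        then obtain a where a: "a < n" "w a = r" "k a = c" using surj by blast
        have "(P a i < 0) \<noteq> (P (Suc a) i < 0)"
          using P(3)[OF a(1)] PM[of a r] PM[of "Suc a" r] a M(2)
          by (simp add: s_def coordinate_sign_normalised rc)
        moreover have "P (Suc a) i = P a i \<or> even (P a i) \<and> odd (P (Suc a) i) \<and> \<bar>P (Suc a) i - P a i\<bar> = 1"
          using chain_coordinate[of n P M a "Suc a" i] P(2) a by auto
        \<comment> \<open>A single move from an even value can change the sign only from 0 to -1.
          Being even, the value 0 was already present at the start.\<close>
        ultimately have "P a i = 0" by presburger
        moreover have "P a i = P 0 i \<or> odd (P a i)"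
          using chain_coordinate[of n P M 0 a i] P(2) a by auto
        ultimately show ?thesis using P(1) False rc by (simp add: Z_def)
      qed
    qed
  qed
  have sec: "flip_invariant M (foldr (jump M) ?ss (\<lambda>_. 1))"
    by (rule flip_invariant_foldr_jump) (auto simp: flip_invariant_def s_def intro: sign_section_coordinate_sign[OF M(2)])
  have fv: "finite (vertices M :: ('r \<times> 'c \<Rightarrow> int) set)"
    by (rule finite_subset[OF vertices_subset]) simp
  have "\<not> first_sign c0 r (Z 0)" for r using M(2) by (auto simp: first_sign_def Z_def)
  then have "(\<Sum>p\<in>{p\<in>vertices M. \<forall>r\<in>UNIV. \<not> first_sign c0 r p}. foldr (jump M) ?ss (\<lambda>_. 1) p) =
     (\<Sum>p\<in>{Z 0}. foldr (jump M) ?ss (\<lambda>_. 1) p)"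
  proof (intro sum.mono_neutral_right ballI)
    fix p assume "p \<in> {p\<in>vertices M. \<forall>r\<in>UNIV. \<not> first_sign c0 r p} - {Z 0}"
    then show "foldr (jump M) ?ss (\<lambda>_. 1) p = 0" using zero[of p] by blast
  qed (use Z0 fv in auto)
  then have "(\<Sum>p\<in>{p\<in>vertices M. \<forall>r\<in>UNIV. \<not> first_sign c0 r p}. foldr (jump M) ?ss (\<lambda>_. 1) p) = 1"
    using one[of 0] by simp
  then show ?thesis
    using sum_flip_invariant_rows[where s = "first_sign c0" and R = UNIV,
        OF vertices_subset vertices_flip sign_section_first_sign[OF M(2)] sec]
    by (simp add: chain_sum_def s_def[abs_def])
qed

lemma count_list_take_less:
  assumes "a < b" "b \<le> length w" shows "count_list (take a w) (w ! a) < count_list (take b w) (w ! a)"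
proof -
  have "take b w = take a w @ w ! a # drop (Suc a) (take b w)"
    using assms id_take_nth_drop[of a "take b w"] by (simp add: min_def)
  then have "count_list (take b w) (w ! a) = count_list (take a w @ w ! a # drop (Suc a) (take b w)) (w ! a)"
    by (rule arg_cong)
  also have "\<dots> > count_list (take a w) (w ! a)" by simp
  finally show ?thesis .
qed

lemma ex_nth_occurrence:
  "k < count_list w r \<Longrightarrow> \<exists>a<length w. w ! a = r \<and> count_list (take a w) r = k"
proof (induction w rule: rev_induct)
  case (snoc x w)
  show ?case
  proof (cases "k < count_list w r")
    case True
    then obtain a where "a < length w" "w ! a = r" "count_list (take a w) r = k" using snoc.IH by blast
    then show ?thesis by (intro exI[of _ a]) (auto simp: nth_append)
  next
    case False
    then have "x = r" "k = count_list w r" using snoc.prems by (auto split: if_splits)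
    then show ?thesis by (intro exI[of _ "length w"]) auto
  qed
qed simp

text \<open>Repeated factors of a row are represented by different coordinates. If every row occurs
  as often as its sphere has dimensions, each coordinate except the spare one is used once;
  otherwise, the total length being right, some row occurs too often and uses up all of its
  coordinates.\<close>

lemma chain_sum_word:
  fixes w :: "'r::finite list" and b :: "'r \<Rightarrow> ('r \<times> 'c::finite \<Rightarrow> int) \<Rightarrow> bool"
  assumes M: "even M" "M > 0" and b: "\<And>r. sign_section M {r} (b r)"
    and len: "length w = CARD('r) * (CARD('c) - 1)"
  shows "[chain_sum M (map b w) = (if \<forall>r. count_list w r = CARD('c) - 1 then 2 ^ CARD('r) else 0)]
    (mod 2 ^ Suc (CARD('r)))"
proof -
  define n where "n = CARD('c) - 1"
  have "CARD('c) = Suc n" by (simp add: n_def)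
  then obtain g where "bij_betw g {..<Suc n} (UNIV :: 'c set)"
    using ex_bij_betw_nat_finite[of "UNIV :: 'c set"] by (auto simp: atLeast0LessThan)
  then have g: "inj_on g {..n}" "g ` {..n} = UNIV" by (auto simp: bij_betw_def lessThan_Suc_atMost)
  \<comment> \<open>Position \<open>a\<close> receives the coordinate numbered by the earlier
    occurrences of the same row; \<open>g n\<close> is the spare coordinate.\<close>
  define k where "k a = g (count_list (take a w) (w ! a))" for a
  let ?ss = "map (\<lambda>a. coordinate_sign (g n) (k a) (w ! a)) [0..<length w]"
  \<comment> \<open>Expanding along singleton sets amounts to changing the representatives
    \<open>b\<close> into coordinate signs.\<close>
  have "[chain_sum M ([] @ ?ss) = (\<Sum>w\<in>listset (map (\<lambda>r. {r}) w). chain_sum M ([] @ map b w))] (mod 2 ^ Suc (CARD('r)))"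
    by (rule chain_sum_expand[OF M _ b])
      (use len in \<open>auto simp: list_all2_conv_all_nth sign_section_coordinate_sign[OF M(2)]\<close>)
  moreover have "listset (map (\<lambda>r. {r}) w) = {w}" by (induction w) (auto simp: set_Cons_def)
  ultimately have 1: "[chain_sum M (map b w) = chain_sum M ?ss] (mod 2 ^ Suc (CARD('r)))"
    by (simp add: cong_sym_eq)
  have hit: "\<exists>a<length w. w ! a = r \<and> k a = g j" if "j < count_list w r" for r j
    using ex_nth_occurrence[OF that] by (auto simp: k_def)
  show ?thesis
  proof (cases "\<forall>r. count_list w r = CARD('c) - 1")
    case True
    then have cnt: "count_list w r = n" for r by (simp add: n_def)
    have occ: "count_list (take a w) (w ! a) < n" if "a < length w" for a
      using count_list_take_less[OF that, of w] cnt[of "w ! a"] by simp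
    have kinj: "a = b" if ab: "a < length w" "b < length w" "w ! a = w ! b" "k a = k b" for a b
    proof -
      have "count_list (take a w) (w ! a) = count_list (take b w) (w ! b)"
        using ab(4) occ[OF ab(1)] occ[OF ab(2)] inj_onD[OF g(1)] unfolding k_def by (meson atMost_iff less_imp_le)
      then show ?thesis
        using count_list_take_less[of a b w] count_list_take_less[of b a w] ab
        by (metis less_imp_le less_irrefl linorder_neqE_nat)
    qed
    have "chain_sum M ?ss = 2 ^ CARD('r)"
    proof (rule chain_sum_coordinates_one[OF M])
      fix r :: 'r and c assume "c \<noteq> g n"
      then obtain j where "j \<le> n" "c = g j" using g(2) by (metis UNIV_I atMost_iff image_iff)
      then have "j < count_list w r" using cnt \<open>c \<noteq> g n\<close> by (metis le_neq_implies_less)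
      then show "\<exists>a<length w. w ! a = r \<and> k a = c" using hit \<open>c = g j\<close> by blast
    next
      fix a assume "a < length w"
      then show "k a \<noteq> g n" using occ g(1) unfolding k_def by (metis atMost_iff inj_onD less_imp_le less_irrefl order_refl)
    qed (use kinj in blast)
    then show ?thesis using 1 True by simp
  next
    case False
    have "\<exists>r. n < count_list w r"
    proof (rule ccontr)
      assume "\<not> ?thesis"
      then have le: "count_list w r \<le> n" for r by (meson not_less)
      have "(\<Sum>r\<in>UNIV. count_list w r) = length w"
        by (rule sum_count_set) auto
      then have "(\<Sum>r\<in>UNIV. count_list w r) = (\<Sum>r\<in>(UNIV::'r set). n)" using len by (simp add: n_def)
      then have "\<forall>r. count_list w r = n"
        using sum_mono_inv[of "count_list w" UNIV "\<lambda>_. n"] le by auto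
      then show False using False by (simp add: n_def)
    qed
    then obtain r where r: "n < count_list w r" ..
    have "chain_sum M ?ss = 0"
    proof (rule chain_sum_coordinates_zero[OF M])
      fix c
      obtain j where "j \<le> n" "c = g j" using g(2) by (metis UNIV_I atMost_iff image_iff)
      then show "\<exists>a<length w. w ! a = r \<and> k a = c" using hit[of j r] r by auto
    qed
    then show ?thesis unfolding if_not_P[OF False] using 1 by simp
  qed
qed

text \<open>The parity hypothesis says that the top monomial has an odd coefficient in the product
  of the linear forms. The chain sum is then an odd multiple of 2^R modulo 2^(R+1), hence
  nonzero.\<close>

theorem ex_sign_changing_chain:
  fixes ss :: "(('r::finite \<times> 'c::finite \<Rightarrow> int) \<Rightarrow> bool) list"
  assumes M: "even M" "M > 0" and ss: "list_all2 (sign_section M) Js ss"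
    and len: "length ss = CARD('r) * (CARD('c) - 1)"
    and odd: "odd (card {w \<in> listset Js. \<forall>r. count_list w r = CARD('c) - 1})"
  obtains P where "P 0 \<in> cells M" "\<And>a. a < length ss \<Longrightarrow> P (Suc a) \<in> covers M (P a)"
    "\<And>a. a < length ss \<Longrightarrow> (ss ! a) (P a) \<noteq> (ss ! a) (P (Suc a))"
proof -
  define b :: "'r \<Rightarrow> ('r \<times> 'c \<Rightarrow> int) \<Rightarrow> bool" where "b = first_sign undefined"
  have b: "sign_section M {r} (b r)" for r
    unfolding b_def by (rule sign_section_first_sign[OF M(2)])
  let ?W = "{w \<in> listset Js. \<forall>r. count_list w r = CARD('c) - 1}"
  have listset_length: "length w = length Js" if "w \<in> listset Js" for w
    using that by (induction Js arbitrary: w) (auto simp: set_Cons_def)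
  have fin: "finite (listset Js)"
    by (rule finite_subset[OF _ finite_lists_length_eq[of "UNIV :: 'r set" "length Js"]])
      (auto simp: listset_length)
  have lJ: "length Js = CARD('r) * (CARD('c) - 1)" using ss len by (simp add: list_all2_lengthD)
  have "[chain_sum M ([] @ ss) = (\<Sum>w\<in>listset Js. chain_sum M ([] @ map b w))] (mod 2 ^ Suc (CARD('r)))"
    by (rule chain_sum_expand[OF M _ b _ ss]) (use len in auto)
  also have "[(\<Sum>w\<in>listset Js. chain_sum M ([] @ map b w)) =
      (\<Sum>w\<in>listset Js. if \<forall>r. count_list w r = CARD('c) - 1 then 2 ^ CARD('r) else 0)] (mod 2 ^ Suc (CARD('r)))"
    using chain_sum_word[OF M b] listset_length lJ by (intro cong_sum) simp
  also have "(\<Sum>w\<in>listset Js. if \<forall>r. count_list w r = CARD('c) - 1 then 2 ^ CARD('r) else 0) = int (card ?W) * 2 ^ CARD('r)"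
    using fin by (simp add: sum.If_cases Int_def)
  finally have *: "[chain_sum M ss = int (card ?W) * 2 ^ CARD('r)] (mod 2 ^ Suc (CARD('r)))" by simp
  have "chain_sum M ss \<noteq> 0"
  proof
    assume "chain_sum M ss = 0"
    then have "2 ^ CARD('r) * 2 dvd 2 ^ CARD('r) * int (card ?W)" using *
      by (simp add: cong_iff_dvd_diff mult.commute)
    then have "2 dvd int (card ?W)" by (subst (asm) dvd_mult_cancel_left) simp
    then show False using odd by simp
  qed
  then obtain p where p: "p \<in> vertices M" "foldr (jump M) ss (\<lambda>_. 1) p \<noteq> 0"
    unfolding chain_sum_def by (meson sum.not_neutral_contains_not_neutral)
  from ex_chain[OF p(2)] obtain P where "P 0 = p"
    "\<forall>a<length ss. P (Suc a) \<in> covers M (P a) \<and> (ss ! a) (P a) \<noteq> (ss ! a) (P (Suc a))" by blast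
  then show ?thesis using p(1) vertices_subset by (intro that[of P]) auto
qed

section \<open>A Borsuk-Ulam theorem for products of cube boundaries\<close>

definition cube_boundaries :: "(real ^ 'c ^ 'r) set" where
  "cube_boundaries = {x. \<forall>r. (\<forall>c. \<bar>x $ r $ c\<bar> \<le> 1) \<and> (\<exists>c. \<bar>x $ r $ c\<bar> = 1)}"

definition negate_row :: "'r \<Rightarrow> 'a::uminus ^ 'r \<Rightarrow> 'a ^ 'r" where
  "negate_row r x = (\<chi> i. if i = r then - x $ i else x $ i)"

definition grid_point :: "int \<Rightarrow> ('r \<times> 'c \<Rightarrow> int) \<Rightarrow> real ^ 'c ^ 'r" where
  "grid_point M p = (\<chi> r c. of_int (p (r, c)) / of_int M)"

lemma compact_cube_boundaries: "compact (cube_boundaries :: (real ^ 'c ^ 'r) set)"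
proof -
  let ?B = "cbox (- (\<chi> r c. 1)) (\<chi> r c. 1) :: (real ^ 'c ^ 'r) set"
  have "cube_boundaries = (\<Inter>r. (\<Inter>c. {x :: real ^ 'c ^ 'r. \<bar>x $ r $ c\<bar> \<le> 1}) \<inter> (\<Union>c. {x. \<bar>x $ r $ c\<bar> = 1}))"
    by (auto simp: cube_boundaries_def)
  also have "closed \<dots>"
    by (intro closed_INT closed_Int closed_UN closed_Collect_le closed_Collect_eq continuous_intros ballI) auto
  finally have "compact (?B \<inter> cube_boundaries)" by (intro compact_Int_closed compact_cbox)
  moreover have "cube_boundaries \<subseteq> ?B"
    by (auto simp: cube_boundaries_def cbox_def Basis_vec_def inner_axis abs_le_iff minus_le_iff)
  ultimately show ?thesis by (simp add: Int_absorb1)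
qed

lemma grid_point_in_cube_boundaries:
  assumes "M > 0" "p \<in> cells M" shows "grid_point M p \<in> cube_boundaries"
  unfolding cube_boundaries_def
proof (intro CollectI allI conjI)
  have 1: "\<bar>grid_point M p $ r $ c\<bar> = of_int \<bar>p (r, c)\<bar> / of_int M" for r c
    using assms(1) by (simp add: grid_point_def)
  fix r
  have "\<bar>p (r, c)\<bar> \<le> M" for c using assms(2) by (auto simp: cells_def)
  then show "\<bar>grid_point M p $ r $ c\<bar> \<le> 1" for c
    unfolding 1 using assms(1) by (simp only: divide_le_eq_1 of_int_le_iff of_int_0_less_iff) simp
  obtain c where "\<bar>p (r, c)\<bar> = M" using assms(2) by (auto simp: cells_def)
  then show "\<exists>c. \<bar>grid_point M p $ r $ c\<bar> = 1"
    unfolding 1 using assms(1) by (intro exI[of _ c]) simp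
qed

lemma grid_point_flip: "grid_point M (flip r p) = negate_row r (grid_point M p)"
  by (simp add: grid_point_def negate_row_def flip_def vec_eq_iff)

text \<open>A substitute sign on cells where a function vanishes: the product of the row signs over
  \<open>J\<close> has the same behaviour under flips.\<close>

lemma sign_section_parity:
  fixes J :: "'r::finite set"
  assumes "M > 0" shows "sign_section M J (\<lambda>p. odd (card {r \<in> J. first_sign c0 r p}))"
  unfolding sign_section_def
proof (intro ballI allI)
  fix p :: "'r \<times> 'a \<Rightarrow> int" and r assume p: "p \<in> cells M"
  have sf: "first_sign c0 r' (flip r p) \<longleftrightarrow> (first_sign c0 r' p \<noteq> (r = r'))" for r'
    using sign_section_first_sign[OF assms, of r' c0] p unfolding sign_section_def by blast
  let ?A = "{r' \<in> J. first_sign c0 r' p}"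
  have "{r' \<in> J. first_sign c0 r' (flip r p)} = (if r \<in> J then if r \<in> ?A then ?A - {r} else insert r ?A else ?A)"
    by (auto simp: sf)
  moreover have "r \<in> ?A \<Longrightarrow> card ?A > 0" by (auto simp: card_gt_0_iff)
  ultimately show "odd (card {r' \<in> J. first_sign c0 r' (flip r p)}) = (odd (card ?A) \<noteq> (r \<in> J))"
    by auto
qed

lemma sign_section_function:
  fixes f :: "real ^ 'c ^ 'r \<Rightarrow> real"
  assumes "M > 0"
    and f: "\<And>x r. x \<in> cube_boundaries \<Longrightarrow> f (negate_row r x) = (if r \<in> J then - f x else f x)"
  shows "sign_section M J (\<lambda>p. if f (grid_point M p) \<noteq> 0 then f (grid_point M p) < 0
      else odd (card {r \<in> J. first_sign c0 r p}))"
  unfolding sign_section_def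
proof (intro ballI allI)
  fix p :: "'r \<times> 'c \<Rightarrow> int" and r assume p: "p \<in> cells M"
  have "odd (card {r' \<in> J. first_sign c0 r' (flip r p)}) \<longleftrightarrow> (odd (card {r' \<in> J. first_sign c0 r' p}) \<noteq> (r \<in> J))"
    using sign_section_parity[OF assms(1), of J c0] p unfolding sign_section_def by blast
  moreover have "f (grid_point M (flip r p)) = (if r \<in> J then - f (grid_point M p) else f (grid_point M p))"
    unfolding grid_point_flip by (intro f grid_point_in_cube_boundaries assms(1) p)
  ultimately show "(if f (grid_point M (flip r p)) \<noteq> 0 then f (grid_point M (flip r p)) < 0
      else odd (card {r' \<in> J. first_sign c0 r' (flip r p)})) \<longleftrightarrow>
     ((if f (grid_point M p) \<noteq> 0 then f (grid_point M p) < 0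
      else odd (card {r' \<in> J. first_sign c0 r' p})) \<noteq> (r \<in> J))"
    by auto
qed

lemma in_listset_iff: "w \<in> listset Js \<longleftrightarrow> list_all2 (\<in>) w Js"
  by (induction Js arbitrary: w) (auto simp: set_Cons_def list_all2_Cons2)

lemma count_list_map_distinct:
  "distinct xs \<Longrightarrow> count_list (map m xs) r = card {e \<in> set xs. m e = r}"
proof (induction xs)
  case (Cons x xs)
  have "{e \<in> set (x # xs). m e = r} = (if m x = r then insert x {e \<in> set xs. m e = r} else {e \<in> set xs. m e = r})"
    by auto
  then show ?case using Cons by auto
qed simp

text \<open>The last hypotheses say that exactly one choice of a row for each equation fills all
  rows, so the parity count is 1. All cells of the resulting chain lie within 1/M of its first
  vertex in each coordinate.\<close>

lemma approximate_common_zero: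
  fixes f :: "'e \<Rightarrow> real ^ 'c ^ 'r \<Rightarrow> real"
  assumes M: "even M" "M > 0"
    and E: "finite E" "card E = CARD('r) * (CARD('c) - 1)"
    and f: "\<And>e x r. e \<in> E \<Longrightarrow> x \<in> cube_boundaries \<Longrightarrow> f e (negate_row r x) = (if r \<in> J e then - f e x else f e x)"
    and m: "\<And>e. e \<in> E \<Longrightarrow> m e \<in> J e" "\<And>r. card {e \<in> E. m e = r} = CARD('c) - 1"
    and uniq: "\<And>w e. (\<And>e. e \<in> E \<Longrightarrow> w e \<in> J e) \<Longrightarrow> (\<And>r. card {e \<in> E. w e = r} = CARD('c) - 1) \<Longrightarrow> e \<in> E \<Longrightarrow> w e = m e"
  shows "\<exists>x\<in>cube_boundaries. \<forall>e\<in>E. \<exists>y\<in>cube_boundaries. \<exists>z\<in>cube_boundaries.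
    (\<forall>r c. \<bar>y $ r $ c - x $ r $ c\<bar> \<le> 1 / of_int M) \<and> (\<forall>r c. \<bar>z $ r $ c - x $ r $ c\<bar> \<le> 1 / of_int M) \<and> f e y * f e z \<le> 0"
proof -
  obtain xs where xs: "set xs = E" "distinct xs" using finite_distinct_list[OF E(1)] by blast
  then have len: "length xs = CARD('r) * (CARD('c) - 1)" using E(2) distinct_card by metis
  define s where "s e p = (if f e (grid_point M p) \<noteq> 0 then f e (grid_point M p) < 0
      else odd (card {r \<in> J e. first_sign undefined r p}))" for e p
  have "sign_section M (J e) (s e)" if "e \<in> E" for e
    unfolding s_def by (rule sign_section_function[OF M(2)]) (use f that in blast)
  then have sec: "list_all2 (sign_section M) (map J xs) (map s xs)"
    by (auto simp: list_all2_conv_all_nth xs(1)[symmetric])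
  have "{w \<in> listset (map J xs). \<forall>r. count_list w r = CARD('c) - 1} = {map m xs}"
  proof (intro equalityI subsetI)
    fix w assume "w \<in> {w \<in> listset (map J xs). \<forall>r. count_list w r = CARD('c) - 1}"
    then have w: "length w = length xs" "\<And>i. i < length xs \<Longrightarrow> w ! i \<in> J (xs ! i)" "\<And>r. count_list w r = CARD('c) - 1"
      by (auto simp: in_listset_iff list_all2_conv_all_nth)
    define v where "v e = the (map_of (zip xs w) e)" for e
    have v: "v (xs ! i) = w ! i" if "i < length xs" for i
      using map_of_zip_nth[of xs w i] xs(2) w(1) that by (simp add: v_def)
    then have wv: "w = map v xs" using w(1) by (simp add: list_eq_iff_nth_eq)
    have "v e = m e" if "e \<in> E" for e
    proof (rule uniq[OF _ _ that])
      show "v e \<in> J e" if "e \<in> E" for e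
        using that v w(2) by (auto simp: xs(1)[symmetric] in_set_conv_nth)
      show "card {e \<in> E. v e = r} = CARD('c) - 1" for r
        using w(3)[of r] count_list_map_distinct[OF xs(2), of v r] by (simp add: wv xs(1))
    qed
    then show "w \<in> {map m xs}" using wv xs(1) by auto
  next
    fix w assume "w \<in> {map m xs}"
    then show "w \<in> {w \<in> listset (map J xs). \<forall>r. count_list w r = CARD('c) - 1}"
      using m xs by (auto simp: in_listset_iff list_all2_conv_all_nth count_list_map_distinct)
  qed
  then have odd: "odd (card {w \<in> listset (map J xs). \<forall>r. count_list w r = CARD('c) - 1})" by simp
  obtain P where P: "P 0 \<in> cells M" "\<And>a. a < length xs \<Longrightarrow> P (Suc a) \<in> covers M (P a)"
    "\<And>a. a < length xs \<Longrightarrow> (map s xs ! a) (P a) \<noteq> (map s xs ! a) (P (Suc a))"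
    using ex_sign_changing_chain[OF M sec _ odd] len by auto
  have Pc: "P a \<in> cells M" if "a \<le> length xs" for a
    using that P(1) P(2)[of "a - 1"] covers_cells by (cases a) auto
  have near: "\<bar>grid_point M (P a) $ r $ c - grid_point M (P 0) $ r $ c\<bar> \<le> 1 / of_int M" if a: "a \<le> length xs" for a r c
  proof -
    have "\<bar>P a (r, c) - P 0 (r, c)\<bar> \<le> 1"
      using chain_coordinate[of "length xs" P M 0 a "(r, c)", OF P(2) _ a] by auto
    then have "\<bar>real_of_int (P a (r, c) - P 0 (r, c))\<bar> \<le> 1" by linarith
    then show ?thesis using M(2)
      by (simp add: grid_point_def diff_divide_distrib[symmetric] divide_right_mono)
  qed
  show ?thesis
  proof (rule bexI[of _ "grid_point M (P 0)"], rule ballI)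
    fix e assume "e \<in> E"
    then obtain a where a: "a < length xs" "xs ! a = e" using xs(1) by (metis in_set_conv_nth)
    have "s e (P a) \<noteq> s e (P (Suc a))" using P(3)[OF a(1)] a by simp
    \<comment> \<open>The recorded sign is that of \<open>f e\<close> wherever this is nonzero, so a
      change means opposite signs or a zero.\<close>
    then have "f e (grid_point M (P a)) * f e (grid_point M (P (Suc a))) \<le> 0"
      by (auto simp: s_def mult_le_0_iff split: if_splits)
    then show "\<exists>y\<in>cube_boundaries. \<exists>z\<in>cube_boundaries. (\<forall>r c. \<bar>y $ r $ c - grid_point M (P 0) $ r $ c\<bar> \<le> 1 / of_int M) \<and>
        (\<forall>r c. \<bar>z $ r $ c - grid_point M (P 0) $ r $ c\<bar> \<le> 1 / of_int M) \<and> f e y * f e z \<le> 0"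
      using a near[of a] near[of "Suc a"] grid_point_in_cube_boundaries[OF M(2) Pc[of a]]
        grid_point_in_cube_boundaries[OF M(2) Pc[of "Suc a"]]
      by (meson Suc_leI less_imp_le)
  qed (use grid_point_in_cube_boundaries[OF M(2) P(1)] in simp)
qed

text \<open>Refining the grid and passing to a convergent subsequence turns each pair of opposite
  signs into a nonpositive square at the limit point.\<close>

theorem product_borsuk_ulam:
  fixes f :: "'e \<Rightarrow> real ^ 'c ^ 'r \<Rightarrow> real"
  assumes E: "finite E" "card E = CARD('r) * (CARD('c) - 1)"
    and cont: "\<And>e. e \<in> E \<Longrightarrow> continuous_on cube_boundaries (f e)"
    and f: "\<And>e x r. e \<in> E \<Longrightarrow> x \<in> cube_boundaries \<Longrightarrow> f e (negate_row r x) = (if r \<in> J e then - f e x else f e x)"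
    and m: "\<And>e. e \<in> E \<Longrightarrow> m e \<in> J e" "\<And>r. card {e \<in> E. m e = r} = CARD('c) - 1"
    and uniq: "\<And>w e. (\<And>e. e \<in> E \<Longrightarrow> w e \<in> J e) \<Longrightarrow> (\<And>r. card {e \<in> E. w e = r} = CARD('c) - 1) \<Longrightarrow> e \<in> E \<Longrightarrow> w e = m e"
  shows "\<exists>x\<in>cube_boundaries. \<forall>e\<in>E. f e x = 0"
proof -
  define M :: "nat \<Rightarrow> int" where "M k = 2 * int (Suc k)" for k
  have "\<exists>x\<in>cube_boundaries. \<forall>e\<in>E. \<exists>y\<in>cube_boundaries. \<exists>z\<in>cube_boundaries.
    (\<forall>r c. \<bar>y $ r $ c - x $ r $ c\<bar> \<le> 1 / of_int (M k)) \<and> (\<forall>r c. \<bar>z $ r $ c - x $ r $ c\<bar> \<le> 1 / of_int (M k)) \<and> f e y * f e z \<le> 0" for k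
    by (rule approximate_common_zero[where E = E and J = J and m = m, OF _ _ E])
      (fact f | fact m | (rule uniq; assumption) | simp add: M_def)+
  then obtain X Y Z where X: "\<And>k. X k \<in> cube_boundaries"
    and YZ: "\<And>k e. e \<in> E \<Longrightarrow> Y k e \<in> cube_boundaries" "\<And>k e. e \<in> E \<Longrightarrow> Z k e \<in> cube_boundaries"
    "\<And>k e r c. e \<in> E \<Longrightarrow> \<bar>Y k e $ r $ c - X k $ r $ c\<bar> \<le> 1 / of_int (M k)"
    "\<And>k e r c. e \<in> E \<Longrightarrow> \<bar>Z k e $ r $ c - X k $ r $ c\<bar> \<le> 1 / of_int (M k)"
    "\<And>k e. e \<in> E \<Longrightarrow> f e (Y k e) * f e (Z k e) \<le> 0"
    by metis
  obtain x \<phi> where x: "x \<in> cube_boundaries" "strict_mono \<phi>" "(X \<circ> \<phi>) \<longlonglongrightarrow> x"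
    using compact_cube_boundaries X by (metis compact_def)
  have M0: "(\<lambda>k. 1 / real_of_int (M (\<phi> k))) \<longlonglongrightarrow> 0"
  proof -
    have "(\<lambda>k. 1 / real_of_int (M k)) \<longlonglongrightarrow> 0"
      unfolding M_def by real_asymp
    then show ?thesis using LIMSEQ_subseq_LIMSEQ[OF _ x(2)] by (auto simp: o_def)
  qed
  have lim: "(\<lambda>k. W (\<phi> k)) \<longlonglongrightarrow> x" if "\<And>k r c. \<bar>W k $ r $ c - X k $ r $ c\<bar> \<le> 1 / of_int (M k)" for W
  proof (intro vec_tendstoI)
    fix r c
    have "(\<lambda>k. W (\<phi> k) $ r $ c - X (\<phi> k) $ r $ c) \<longlonglongrightarrow> 0"
      by (rule Lim_null_comparison[OF _ M0]) (use that in auto)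
    moreover have "(\<lambda>k. X (\<phi> k) $ r $ c) \<longlonglongrightarrow> x $ r $ c"
      using x(3) by (intro tendsto_vec_nth) (simp add: o_def)
    ultimately show "(\<lambda>k. W (\<phi> k) $ r $ c) \<longlonglongrightarrow> x $ r $ c"
      using tendsto_add by fastforce
  qed
  have "f e x = 0" if e: "e \<in> E" for e
  proof -
    have flim: "(\<lambda>k. f e (W (\<phi> k))) \<longlonglongrightarrow> f e x"
      if "\<And>k. W k \<in> cube_boundaries" "\<And>k r c. \<bar>W k $ r $ c - X k $ r $ c\<bar> \<le> 1 / of_int (M k)" for W
      by (rule continuous_on_tendsto_compose[OF cont[OF e] lim[OF that(2)] x(1)]) (use that in auto)
    have "(\<lambda>k. f e (Y (\<phi> k) e) * f e (Z (\<phi> k) e)) \<longlonglongrightarrow> f e x * f e x"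
      by (intro tendsto_mult flim[of "\<lambda>k. Y k e"] flim[of "\<lambda>k. Z k e"]) (use YZ e in auto)
    then have "f e x * f e x \<le> 0"
      by (rule tendsto_upperbound) (use YZ(5) e in auto)
    then show ?thesis by (metis mult_eq_0_iff order_antisym zero_le_square)
  qed
  then show ?thesis using x(1) by blast
qed

section \<open>Unitary frames\<close>

definition cinner :: "complex ^ 'd \<Rightarrow> complex ^ 'd \<Rightarrow> complex" where
  "cinner x y = (\<Sum>k\<in>UNIV. x $ k * cnj (y $ k))"

definition unitary_frame :: "complex ^ 'd ^ 'd \<Rightarrow> bool" where
  "unitary_frame v \<longleftrightarrow> (\<forall>i j. cinner (v $ i) (v $ j) = of_bool (i = j))"

lemma cinner_minus_left [simp]: "cinner (- x) y = - cinner x y"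
  by (simp add: cinner_def sum_negf)

lemma cinner_minus_right [simp]: "cinner x (- y) = - cinner x y"
  by (simp add: cinner_def sum_negf)

lemma cnj_cinner: "cnj (cinner x y) = cinner y x"
  by (simp add: cinner_def mult.commute)

lemma cinner_scaleR_left: "cinner (a *\<^sub>R x) y = a *\<^sub>R cinner x y"
  by (simp add: cinner_def scaleR_sum_right)

lemma cinner_self: "cinner x x = complex_of_real ((norm x)\<^sup>2)"
  by (simp add: cinner_def norm_vec_def L2_set_def sum_nonneg complex_norm_square[symmetric])

lemma cinner_sum_left: "cinner (\<Sum>i\<in>I. f i) z = (\<Sum>i\<in>I. cinner (f i) z)"
  by (simp add: cinner_def sum_distrib_right) (rule sum.swap)

lemma card_rows_below:
  fixes \<rho> :: "'d::finite \<Rightarrow> nat"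
  assumes \<rho>: "bij_betw \<rho> UNIV {..<CARD('d)}" and i: "i \<le> CARD('d)"
  shows "card {j. \<rho> j < i} = i"
proof -
  have "\<rho> ` {j. \<rho> j < i} = {..<i}"
  proof (intro equalityI subsetI)
    fix n assume n: "n \<in> {..<i}"
    then have "n \<in> range \<rho>" using \<rho> i by (simp add: bij_betw_def)
    then show "n \<in> \<rho> ` {j. \<rho> j < i}" using n by auto
  qed auto
  then show ?thesis
    using card_image[of \<rho> "{j. \<rho> j < i}"] inj_on_subset[of \<rho> UNIV] \<rho> by (simp add: bij_betw_def)
qed

lemma continuous_on_cinner [continuous_intros]:
  "continuous_on S f \<Longrightarrow> continuous_on S g \<Longrightarrow> continuous_on S (\<lambda>x. cinner (f x) (g x))"
  unfolding cinner_def by (intro continuous_intros)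

text \<open>The trivial equations pad the system to the dimension of the product of spheres.\<close>

datatype 'd equation = Incidence nat 'd bool | Orthogonality 'd 'd bool | Trivial 'd

fun equation_rows :: "'d equation \<Rightarrow> 'd set" where
  "equation_rows (Incidence i j b) = {j}"
| "equation_rows (Orthogonality i j b) = {i, j}"
| "equation_rows (Trivial j) = {j}"

fun leading_row :: "'d equation \<Rightarrow> 'd" where
  "leading_row (Incidence i j b) = j"
| "leading_row (Orthogonality i j b) = i"
| "leading_row (Trivial j) = j"

text \<open>The Boolean separates real and imaginary parts. Row \<open>r\<close> leads 2 *
  \<open>\<rho> r\<close> incidences, two orthogonality equations for each row of larger rank and
  one trivial equation. In total this is 2d - 1, the dimension of one sphere.\<close>

definition equations :: "('d \<Rightarrow> nat) \<Rightarrow> 'd equation set" where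
  "equations \<rho> = {Incidence i j b | i j b. 1 \<le> i \<and> i \<le> \<rho> j} \<union>
     {Orthogonality i j b | i j b. \<rho> i < \<rho> j} \<union> range Trivial"

lemma equations_with_leading_row:
  "{e \<in> equations \<rho>. leading_row e = r} =
    (\<lambda>(i, b). Incidence i r b) ` ({1..\<rho> r} \<times> UNIV) \<union>
    ((\<lambda>(j, b). Orthogonality r j b) ` ({j. \<rho> r < \<rho> j} \<times> UNIV) \<union> {Trivial r})"
  by (auto simp: equations_def image_iff)

lemma card_equations_with_leading_row:
  fixes \<rho> :: "'d::finite \<Rightarrow> nat"
  assumes \<rho>: "bij_betw \<rho> UNIV {..<CARD('d)}"
  shows "card {e \<in> equations \<rho>. leading_row e = r} = CARD('d \<times> bool) - 1"
    and "finite {e \<in> equations \<rho>. leading_row e = r}"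
proof -
  have lt: "\<rho> r < CARD('d)" using \<rho> by (auto simp: bij_betw_def)
  have "\<rho> ` {j. \<rho> r < \<rho> j} = {\<rho> r<..<CARD('d)}"
  proof (intro equalityI subsetI)
    fix n assume n: "n \<in> {\<rho> r<..<CARD('d)}"
    then have "n \<in> range \<rho>" using \<rho> by (simp add: bij_betw_def)
    then show "n \<in> \<rho> ` {j. \<rho> r < \<rho> j}" using n by auto
  qed (use \<rho> in \<open>auto simp: bij_betw_def\<close>)
  then have "card {j. \<rho> r < \<rho> j} = CARD('d) - Suc (\<rho> r)"
    using card_image[of \<rho> "{j. \<rho> r < \<rho> j}"] inj_on_subset[of \<rho> UNIV] \<rho> by (simp add: bij_betw_def)
  moreover have "card ((\<lambda>(i, b). Incidence i r b) ` ({1..\<rho> r} \<times> (UNIV :: bool set))) = \<rho> r * 2"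
    by (subst card_image) (auto simp: inj_on_def card_cartesian_product)
  moreover have "card ((\<lambda>(j, b). Orthogonality r j b) ` ({j. \<rho> r < \<rho> j} \<times> (UNIV :: bool set))) = card {j. \<rho> r < \<rho> j} * 2"
    by (subst card_image) (auto simp: inj_on_def card_cartesian_product)
  moreover have "card {e \<in> equations \<rho>. leading_row e = r} =
      card ((\<lambda>(i, b). Incidence i r b) ` ({1..\<rho> r} \<times> (UNIV :: bool set))) +
      (card ((\<lambda>(j, b). Orthogonality r j b) ` ({j. \<rho> r < \<rho> j} \<times> (UNIV :: bool set))) + card {Trivial r})"
    unfolding equations_with_leading_row
  proof (subst card_Un_disjoint)
    show "card ((\<lambda>(i, b). Incidence i r b) ` ({1..\<rho> r} \<times> (UNIV :: bool set))) +
        card ((\<lambda>(j, b). Orthogonality r j b) ` ({j. \<rho> r < \<rho> j} \<times> (UNIV :: bool set)) \<union> {Trivial r}) =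
      card ((\<lambda>(i, b). Incidence i r b) ` ({1..\<rho> r} \<times> (UNIV :: bool set))) +
      (card ((\<lambda>(j, b). Orthogonality r j b) ` ({j. \<rho> r < \<rho> j} \<times> (UNIV :: bool set))) + card {Trivial r})"
      by (subst card_Un_disjoint) auto
  qed auto
  ultimately show "card {e \<in> equations \<rho>. leading_row e = r} = CARD('d \<times> bool) - 1"
    using lt by (simp add: card_prod)
  show "finite {e \<in> equations \<rho>. leading_row e = r}"
    unfolding equations_with_leading_row by auto
qed

lemma finite_equations:
  fixes \<rho> :: "'d::finite \<Rightarrow> nat"
  assumes \<rho>: "bij_betw \<rho> UNIV {..<CARD('d)}"
  shows "finite (equations \<rho>)" "card (equations \<rho>) = CARD('d) * (CARD('d \<times> bool) - 1)"
proof -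
  have eq: "equations \<rho> = (\<Union>r. {e \<in> equations \<rho>. leading_row e = r})" by auto
  show "finite (equations \<rho>)"
    by (subst eq) (auto intro: card_equations_with_leading_row(2)[OF \<rho>])
  have "card (\<Union>r. {e \<in> equations \<rho>. leading_row e = r}) = (\<Sum>r\<in>UNIV. card {e \<in> equations \<rho>. leading_row e = r})"
    by (rule card_UN_disjoint) (auto intro: card_equations_with_leading_row(2)[OF \<rho>])
  then show "card (equations \<rho>) = CARD('d) * (CARD('d \<times> bool) - 1)"
    using eq by (simp add: card_equations_with_leading_row(1)[OF \<rho>])
qed

text \<open>An admissible choice of rows must pick the leading rows: inductively along \<open>\<rho>\<close>, the equations
  that can still be assigned to a row are just enough to fill it.\<close>

lemma leading_row_unique:
  fixes \<rho> :: "'d::finite \<Rightarrow> nat"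
  assumes \<rho>: "bij_betw \<rho> UNIV {..<CARD('d)}"
    and w: "\<And>e. e \<in> equations \<rho> \<Longrightarrow> w e \<in> equation_rows e"
    and card: "\<And>r. card {e \<in> equations \<rho>. w e = r} = CARD('d \<times> bool) - 1"
    and e: "e \<in> equations \<rho>"
  shows "w e = leading_row e"
proof -
  have "\<forall>e. e \<in> equations \<rho> \<and> leading_row e = r \<longrightarrow> w e = r" for r
  proof (induction "\<rho> r" arbitrary: r rule: less_induct)
    case less
    have "{e \<in> equations \<rho>. w e = r} \<subseteq> {e \<in> equations \<rho>. leading_row e = r}"
    proof clarify
      fix e assume e: "e \<in> equations \<rho>" "r = w e"
      show "leading_row e = w e"
      proof (rule ccontr)
        assume ne: "leading_row e \<noteq> w e"
        then obtain i b where i: "e = Orthogonality i (w e) b" using w[OF e(1)] by (cases e) auto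
        \<comment> \<open>An equation choosing \<open>r\<close> without being led by it is an
          orthogonality led by a row of smaller rank, which by induction has already claimed
          it.\<close>
        then have "\<rho> i < \<rho> r" using e by (auto simp: equations_def)
        then have "w e = i" using less e(1) i by (metis leading_row.simps(2))
        then show False using ne i by (metis leading_row.simps(2))
      qed
    qed
    then have "{e \<in> equations \<rho>. w e = r} = {e \<in> equations \<rho>. leading_row e = r}"
      by (intro card_subset_eq card_equations_with_leading_row(2)[OF \<rho>])
        (simp_all only: card card_equations_with_leading_row(1)[OF \<rho>])
    then show ?case by blast
  qed
  then show ?thesis using e by blast
qed

section \<open>Passage from cube boundaries to unit spheres\<close>

definition complex_rows :: "real ^ ('d \<times> bool) ^ 'r \<Rightarrow> complex ^ 'd ^ 'r" where
  "complex_rows x = (\<chi> r k. Complex (x $ r $ (k, False)) (x $ r $ (k, True)))"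

definition normalised_rows :: "real ^ ('d \<times> bool) ^ 'r \<Rightarrow> complex ^ 'd ^ 'r" where
  "normalised_rows x = (\<chi> r. (1 / norm (complex_rows x $ r)) *\<^sub>R complex_rows x $ r)"

lemma complex_rows_negate: "complex_rows (negate_row r x) = negate_row r (complex_rows x)"
  by (simp add: complex_rows_def negate_row_def vec_eq_iff complex_eq_iff)

lemma normalised_rows_negate: "normalised_rows (negate_row r x) = negate_row r (normalised_rows x)"
  by (simp add: normalised_rows_def complex_rows_negate) (simp add: negate_row_def vec_eq_iff)

lemma complex_rows_nonzero:
  assumes "x \<in> cube_boundaries" shows "complex_rows x $ r \<noteq> 0"
proof
  assume eq: "complex_rows x $ r = 0"
  have "x $ r $ (k, b) = 0" for k b
    using arg_cong[OF eq, of "\<lambda>v. v $ k"] by (cases b) (simp_all add: complex_rows_def complex_eq_iff)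
  moreover obtain c where "\<bar>x $ r $ c\<bar> = 1" using assms unfolding cube_boundaries_def by blast
  ultimately show False by (cases c) auto
qed

lemma continuous_on_complex_rows: "continuous_on S complex_rows"
  unfolding complex_rows_def by (intro continuous_intros)

lemma continuous_on_normalised_rows: "continuous_on cube_boundaries normalised_rows"
  unfolding normalised_rows_def
  by (intro continuous_intros continuous_on_complex_rows) (use complex_rows_nonzero in auto)

lemma norm_normalised_rows:
  assumes "x \<in> cube_boundaries" shows "norm (normalised_rows x $ r) = 1"
  using complex_rows_nonzero[OF assms] by (simp add: normalised_rows_def)

fun equation_function ::
    "(nat \<Rightarrow> complex ^ 'd ^ 'd \<Rightarrow> complex ^ 'd) \<Rightarrow> 'd equation \<Rightarrow> complex ^ 'd ^ 'd \<Rightarrow> real" where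
  "equation_function q (Incidence i j b) v = (if b then Im else Re) (cinner (q i v) (v $ j))"
| "equation_function q (Orthogonality i j b) v = (if b then Im else Re) (cinner (v $ i) (v $ j))"
| "equation_function q (Trivial j) v = 0"

lemma equation_function_negate_row:
  assumes "\<And>i. q i (negate_row r v) = q i v" "inj \<rho>" "e \<in> equations \<rho>"
  shows "equation_function q e (negate_row r v) =
    (if r \<in> equation_rows e then - equation_function q e v else equation_function q e v)"
proof (cases e)
  case (Orthogonality i j b)
  then have "i \<noteq> j" using assms(3) by (auto simp: equations_def)
  then show ?thesis using Orthogonality by (auto simp: negate_row_def)
qed (auto simp: assms(1), auto simp: negate_row_def)

lemma continuous_on_equation_function:
  assumes "\<And>i. continuous_on UNIV (q i)" shows "continuous_on UNIV (equation_function q e)"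
proof (cases e)
  case (Incidence i j b)
  have *: "equation_function q e = (\<lambda>v. (if b then Im else Re) (cinner (q i v) (v $ j)))"
    unfolding Incidence by (rule ext) simp
  show ?thesis unfolding * by (cases b) (auto intro!: continuous_intros assms)
next
  case (Orthogonality i j b)
  have *: "equation_function q e = (\<lambda>v. (if b then Im else Re) (cinner (v $ i) (v $ j)))"
    unfolding Orthogonality by (rule ext) simp
  show ?thesis unfolding * by (cases b) (auto intro!: continuous_intros)
next
  case (Trivial j)
  have *: "equation_function q e = (\<lambda>v. 0)"
    unfolding Trivial by (rule ext) simp
  show ?thesis unfolding * by simp
qed

text \<open>The functions \<open>q i\<close> are required on all matrices, because during the search
  the rows are only unit vectors; orthogonality is one of the conditions being solved for.\<close>

theorem ex_unitary_frame_orthogonal: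
  fixes q :: "nat \<Rightarrow> complex ^ 'd ^ 'd \<Rightarrow> complex ^ 'd" and \<rho> :: "'d \<Rightarrow> nat"
  assumes q: "\<And>i. continuous_on UNIV (q i)" "\<And>i r v. q i (negate_row r v) = q i v"
    and \<rho>: "bij_betw \<rho> UNIV {..<CARD('d)}"
  shows "\<exists>v. unitary_frame v \<and> (\<forall>i j. 1 \<le> i \<and> i \<le> \<rho> j \<longrightarrow> cinner (q i v) (v $ j) = 0)"
proof -
  let ?f = "\<lambda>e x. equation_function q e (normalised_rows x)"
  have inj: "inj \<rho>" using \<rho> by (simp add: bij_betw_def)
  have "\<exists>x\<in>cube_boundaries. \<forall>e\<in>equations \<rho>. ?f e x = 0"
  proof (rule product_borsuk_ulam[where J = equation_rows and m = leading_row])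
    fix e :: "'d equation" assume "e \<in> equations \<rho>"
    show "continuous_on cube_boundaries (?f e)"
      by (rule continuous_on_compose2[OF continuous_on_equation_function[OF q(1)] continuous_on_normalised_rows]) auto
    show "leading_row e \<in> equation_rows e" by (cases e) auto
  next
    fix e :: "'d equation" and x :: "real ^ ('d \<times> bool) ^ 'd" and r
    assume "e \<in> equations \<rho>"
    then show "?f e (negate_row r x) = (if r \<in> equation_rows e then - ?f e x else ?f e x)"
      unfolding normalised_rows_negate by (rule equation_function_negate_row[where q = q, OF q(2) inj])
  qed (use finite_equations[OF \<rho>] card_equations_with_leading_row(1)[OF \<rho>] leading_row_unique[OF \<rho>] in auto)
  then obtain x where x: "x \<in> cube_boundaries" "\<And>e. e \<in> equations \<rho> \<Longrightarrow> ?f e x = 0" by blast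
  define v where "v = normalised_rows x"
  have "cinner (v $ i) (v $ j) = 0" if "\<rho> i < \<rho> j" for i j
    using x(2)[of "Orthogonality i j True"] x(2)[of "Orthogonality i j False"] that
    by (auto simp: equations_def v_def complex_eq_iff)
  then have "cinner (v $ i) (v $ j) = 0" if "i \<noteq> j" for i j
    using that inj cnj_cinner[of "v $ j" "v $ i"] by (metis complex_cnj_zero injD linorder_neqE_nat)
  then have "unitary_frame v"
    using norm_normalised_rows[OF x(1)] by (simp add: unitary_frame_def cinner_self v_def)
  moreover have "cinner (q i v) (v $ j) = 0" if "1 \<le> i \<and> i \<le> \<rho> j" for i j
    using x(2)[of "Incidence i j True"] x(2)[of "Incidence i j False"] that
    by (auto simp: equations_def v_def complex_eq_iff)
  ultimately show ?thesis by blast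
qed

section \<open>Centre points in a subspace\<close>

text \<open>The usual induction through Radon's theorem, run inside \<open>L\<close>: the points
  \<open>X S\<close>, common to all sets but \<open>S\<close>, lie in \<open>L\<close>, so more than
  \<open>dim L + 1\<close> of them are affinely dependent. This gives the Helly number of
  \<open>L\<close> instead of that of the ambient space.\<close>

lemma helly_subspace:
  fixes F :: "'a::euclidean_space set set"
  assumes "finite F" "\<And>S. S \<in> F \<Longrightarrow> convex S" "\<And>S. S \<in> F \<Longrightarrow> S \<subseteq> L"
    and "\<And>T. T \<subseteq> F \<Longrightarrow> card T \<le> dim L + 1 \<Longrightarrow> \<Inter>T \<noteq> {}"
  shows "\<Inter>F \<noteq> {}"
  using assms
proof (induction "card F" arbitrary: F rule: less_induct)
  case less
  show ?case
  proof (cases "card F \<le> dim L + 1")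
    case False
    have "\<Inter>(F - {S}) \<noteq> {}" if "S \<in> F" for S
    proof (rule less.hyps)
      show "card (F - {S}) < card F" using less.prems(1) that by (rule card_Diff1_less)
      show "\<Inter>T \<noteq> {}" if "T \<subseteq> F - {S}" "card T \<le> dim L + 1" for T
        using less.prems(4)[of T] that by blast
    qed (use less.prems in auto)
    then have "\<forall>S\<in>F. \<exists>x. x \<in> \<Inter>(F - {S})" by blast
    then obtain X where X: "\<And>S. S \<in> F \<Longrightarrow> X S \<in> \<Inter>(F - {S})" by metis
    have X': "X S \<in> T" if "S \<in> F" "T \<in> F" "S \<noteq> T" for S T using X that by auto
    show ?thesis
    proof (cases "inj_on X F")
      case True
      have XL: "X ` F \<subseteq> L"
      proof
        fix x assume "x \<in> X ` F"
        then obtain S where S: "S \<in> F" "x = X S" by auto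
        have "F \<noteq> {S}" using False by auto
        then obtain T where "T \<in> F" "T \<noteq> S" using S(1) by blast
        then show "x \<in> L" using X'[of S T] S less.prems(3) by blast
      qed
      have "affine_dependent (X ` F)"
        using less.prems(1) False dim_subset[OF XL] by (intro affine_dependent_biggerset_general) (auto simp: card_image[OF True])
      then obtain A B where AB: "A \<subseteq> X ` F" "B \<subseteq> X ` F" "A \<inter> B = {}" "convex hull A \<inter> convex hull B \<noteq> {}"
        by (rule Radon)
      then obtain z where z: "z \<in> convex hull A" "z \<in> convex hull B" by auto
      have "z \<in> S" if S: "S \<in> F" for S
      proof -
        have sub: "C \<subseteq> S" if "C \<subseteq> X ` F" "X S \<notin> C" for C
          using that X'[OF _ S] by (metis imageE subset_eq)
        have "A \<subseteq> S \<or> B \<subseteq> S" using AB(1-3) sub by blast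
        then show ?thesis using z hull_minimal[of _ S convex] less.prems(2)[OF S] by blast
      qed
      then show ?thesis by blast
    next
      case False
      then obtain S T where "S \<in> F" "T \<in> F" "S \<noteq> T" "X S = X T" by (auto simp: inj_on_def)
      then have "X S \<in> \<Inter>F" using X by (metis DiffI InterE InterI singletonD)
      then show ?thesis by blast
    qed
  qed (use less.prems in blast)
qed

lemma center_point:
  fixes \<mu> :: "'a::euclidean_space measure"
  assumes "prob_space \<mu>" and sets: "sets \<mu> = sets borel" and L: "subspace L" "dim L \<le> D"
    and R: "measure \<mu> (cball 0 R) > 1 - 1 / real (D + 1)"
  shows "\<exists>x\<in>L. norm x \<le> R \<and> (\<forall>a\<in>L. measure \<mu> {y. a \<bullet> y \<le> a \<bullet> x} \<ge> 1 / real (D + 1))"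
proof -
  interpret prob_space \<mu> by fact
  have sp: "space \<mu> = UNIV" using sets by (metis sets_eq_imp_space_eq space_borel)
  have sets_le: "{y. a \<bullet> y \<le> b} \<in> sets \<mu>" "{y. a \<bullet> y \<ge> b} \<in> sets \<mu>" for a :: 'a and b
    unfolding sets by (auto intro!: borel_closed closed_halfspace_le closed_halfspace_ge)
  define t where "t = 1 - 1 / real (D + 1)"
  \<comment> \<open>A point of all closed halfspaces of mass above 1 - 1/(D+1) is a centre, because
    otherwise the complement of a shallow halfspace would contain one of them that misses the
    point.\<close>
  define C where "C = {{x. a \<bullet> x \<ge> b} | a b. a \<in> L \<and> measure \<mu> {y. a \<bullet> y \<ge> b} > t}"
  define B where "B = cball 0 R \<inter> L"
  \<comment> \<open>Orthogonal projection to \<open>L\<close> preserves the halfspaces with normal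
    in \<open>L\<close> and does not increase norms; it carries mass estimates over to points of
    \<open>L\<close>.\<close>
  have "\<forall>y. \<exists>z\<in>L. norm z \<le> norm y \<and> (\<forall>a\<in>L. a \<bullet> z = a \<bullet> y)"
  proof
    fix y
    obtain z w where zw: "z \<in> span L" "\<And>u. u \<in> span L \<Longrightarrow> orthogonal w u" "y = z + w"
      using orthogonal_subspace_decomp_exists by metis
    then have zL: "z \<in> L" using L(1) by (metis span_eq_iff)
    have "(norm y)\<^sup>2 = (norm z)\<^sup>2 + (norm w)\<^sup>2"
      unfolding zw(3) by (intro norm_add_Pythagorean) (metis zw(1,2) orthogonal_commute)
    then have "norm z \<le> norm y" by (metis le_add_same_cancel1 norm_ge_zero power2_le_imp_le zero_le_power2)
    moreover have "a \<bullet> z = a \<bullet> y" if "a \<in> L" for a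
      using zw(2)[of a] that L(1) by (simp add: zw(3) inner_add_right orthogonal_def inner_commute span_base)
    ultimately show "\<exists>z\<in>L. norm z \<le> norm y \<and> (\<forall>a\<in>L. a \<bullet> z = a \<bullet> y)" using zL by blast
  qed
  then obtain P where P: "\<And>y. P y \<in> L" "\<And>y. norm (P y) \<le> norm y" "\<And>y a. a \<in> L \<Longrightarrow> a \<bullet> P y = a \<bullet> y"
    by metis
  have "B \<inter> \<Inter>C \<noteq> {}"
  proof (rule compact_imp_fip)
    show "compact B" unfolding B_def by (intro compact_Int_closed compact_cball closed_subspace L)
    show "closed T" if "T \<in> C" for T using that by (auto simp: C_def closed_halfspace_ge)
    fix F' assume F': "finite F'" "F' \<subseteq> C"
    \<comment> \<open>The ball is treated as one more set of large mass. The norm bound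
      \<open>R\<close> thus costs no depth and is the same for every admissible
      \<open>L\<close>.\<close>
    define G where "G = insert B ((\<lambda>K. K \<inter> L) ` F')"
    have "\<Inter>G \<noteq> {}"
    proof (rule helly_subspace[where L = L])
      show "finite G" using F' by (simp add: G_def)
      show "S \<subseteq> L" if "S \<in> G" for S using that by (auto simp: G_def B_def)
      show "convex S" if "S \<in> G" for S
        using that F'(2) subspace_imp_convex[OF L(1)]
        by (auto simp: G_def B_def C_def intro!: convex_Int convex_halfspace_ge)
    next
      fix T assume T: "T \<subseteq> G" "card T \<le> dim L + 1"
      show "\<Inter>T \<noteq> {}"
      proof (cases "T = {}")
        case False
        have "\<exists>A\<in>sets \<mu>. measure \<mu> A > t \<and> (\<forall>y\<in>A. P y \<in> S)" if "S \<in> G" for S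
        proof (cases "S = B")
          case True
          have "\<forall>y\<in>cball 0 R. P y \<in> S"
            using True P(1) order_trans[OF P(2)] by (auto simp: B_def)
          then show ?thesis using R sets by (intro bexI[of _ "cball 0 R"]) (auto simp: t_def)
        next
          case False
          then obtain K where "K \<in> C" "S = K \<inter> L" using \<open>S \<in> G\<close> F'(2) by (auto simp: G_def)
          then obtain a b where ab: "S = {x. a \<bullet> x \<ge> b} \<inter> L" "a \<in> L" "measure \<mu> {y. a \<bullet> y \<ge> b} > t"
            unfolding C_def by blast
          then show ?thesis using P(1,3) sets_le by (intro bexI[of _ "{y. a \<bullet> y \<ge> b}"]) auto
        qed
        then obtain A where A: "\<And>S. S \<in> G \<Longrightarrow> A S \<in> sets \<mu>" "\<And>S. S \<in> G \<Longrightarrow> measure \<mu> (A S) > t"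
          "\<And>S y. S \<in> G \<Longrightarrow> y \<in> A S \<Longrightarrow> P y \<in> S" by metis
        have finT: "finite T" using T(1) F'(1) by (auto simp: G_def intro: finite_subset)
        \<comment> \<open>At most D + 1 complements, each of mass below 1/(D+1), cannot cover the
          space.\<close>
        have "measure \<mu> (\<Union>S\<in>T. space \<mu> - A S) \<le> (\<Sum>S\<in>T. measure \<mu> (space \<mu> - A S))"
          by (rule finite_measure_subadditive_finite[OF finT]) (use A(1) T(1) in auto)
        also have "\<dots> < (\<Sum>S\<in>T. 1 / real (D + 1))"
        proof (rule sum_strict_mono[OF finT False])
          fix S assume "S \<in> T"
          then have S: "S \<in> G" using T(1) by blast
          have "measure \<mu> (space \<mu> - A S) = 1 - measure \<mu> (A S)" "measure \<mu> (A S) > t"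
            using prob_compl[OF A(1)[OF S]] A(2)[OF S] by blast+
          then show "measure \<mu> (space \<mu> - A S) < 1 / real (D + 1)" by (simp add: t_def)
        qed
        also have "\<dots> = real (card T) / real (D + 1)" by simp
        also have "\<dots> \<le> 1" using T(2) L(2) by (simp add: divide_le_eq)
        finally have "(\<Union>S\<in>T. space \<mu> - A S) \<noteq> space \<mu>" using prob_space by auto
        then obtain y where "\<And>S. S \<in> T \<Longrightarrow> y \<in> A S" using sp by auto
        then have "P y \<in> \<Inter>T" using A(3) T(1) by blast
        then show ?thesis by blast
      qed simp
    qed
    moreover have "\<Inter>G \<subseteq> B \<inter> \<Inter>F'" unfolding G_def by blast
    ultimately show "B \<inter> \<Inter>F' \<noteq> {}" by blast
  qed
  then obtain x where x: "x \<in> B" "\<And>K. K \<in> C \<Longrightarrow> x \<in> K" by blast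
  have "measure \<mu> {y. a \<bullet> y \<le> a \<bullet> x} \<ge> 1 / real (D + 1)" if a: "a \<in> L" for a
  proof (rule ccontr)
    assume "\<not> ?thesis"
    moreover have "measure \<mu> (space \<mu> - {y. a \<bullet> y \<le> a \<bullet> x}) = 1 - measure \<mu> {y. a \<bullet> y \<le> a \<bullet> x}"
      by (rule prob_compl) (rule sets_le)
    moreover have "space \<mu> - {y. a \<bullet> y \<le> a \<bullet> x} = {y. a \<bullet> y > a \<bullet> x}" by (auto simp: sp)
    ultimately have gt: "measure \<mu> {y. a \<bullet> y > a \<bullet> x} > t" by (simp add: t_def)
    \<comment> \<open>Closed halfspaces exhausting the open one, since \<open>C\<close> admits only
      closed ones.\<close>
    define A where "A n = {y. a \<bullet> y \<ge> a \<bullet> x + 1 / real (Suc n)}" for n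
    have "(\<lambda>n. measure \<mu> (A n)) \<longlonglongrightarrow> measure \<mu> (\<Union>n. A n)"
    proof (rule finite_Lim_measure_incseq)
      show "range A \<subseteq> sets \<mu>" using sets_le by (auto simp: A_def)
      have "1 / real (Suc n) \<le> 1 / real (Suc m)" if "m \<le> n" for m n
        using that by (simp add: frac_le)
      then show "incseq A" by (fastforce simp: A_def incseq_def)
    qed
    moreover have "(\<Union>n. A n) = {y. a \<bullet> y > a \<bullet> x}"
    proof (intro equalityI subsetI)
      fix y assume "y \<in> {y. a \<bullet> y > a \<bullet> x}"
      then obtain n where "1 / real (Suc n) < a \<bullet> y - a \<bullet> x"
        using nat_approx_posE[of "a \<bullet> y - a \<bullet> x"] by auto
      then show "y \<in> (\<Union>n. A n)" by (auto simp: A_def intro!: exI[of _ n])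
    next
      fix y assume "y \<in> (\<Union>n. A n)"
      then obtain n where "a \<bullet> x + 1 / real (Suc n) \<le> a \<bullet> y" by (auto simp: A_def)
      moreover have "1 / real (Suc n) > 0" by simp
      ultimately show "y \<in> {y. a \<bullet> y > a \<bullet> x}" unfolding mem_Collect_eq by linarith
    qed
    ultimately have "eventually (\<lambda>n. measure \<mu> (A n) > t) sequentially"
      using gt by (intro order_tendstoD) auto
    then obtain n where "measure \<mu> (A n) > t" by (auto simp: eventually_sequentially)
    then have "A n \<in> C" using a by (auto simp: C_def A_def)
    then have "x \<in> A n" by (rule x(2))
    then show False by (simp add: A_def)
  qed
  then show ?thesis using x(1) by (auto simp: B_def)
qed

section \<open>Semicontinuity of halfspace masses\<close>

lemma measure_halfspace_usc:
  fixes \<mu> :: "'a::euclidean_space measure"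
  assumes "finite_measure \<mu>" and sets: "sets \<mu> = sets borel"
    and a: "a \<longlonglongrightarrow> a'" and b: "b \<longlonglongrightarrow> b'" and t: "t \<longlonglongrightarrow> t'"
    and ge: "\<And>n::nat. measure \<mu> {y. a n \<bullet> y \<le> b n} \<ge> t n"
  shows "measure \<mu> {y. a' \<bullet> y \<le> b'} \<ge> t'"
proof -
  interpret finite_measure \<mu> by fact
  have sets_le: "{y. a \<bullet> y \<le> b} \<in> sets \<mu>" for a :: 'a and b
    unfolding sets by (auto intro!: borel_closed closed_halfspace_le)
  \<comment> \<open>The intersection of the decreasing sets \<open>U n\<close> is the upper limit of
    the halfspaces, and a point lying in infinitely many of them lies in the limiting closed
    halfspace.\<close>
  define U where "U n = (\<Union>m\<in>{n..}. {y. a m \<bullet> y \<le> b m})" for n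
  have U: "U n \<in> sets \<mu>" for n unfolding U_def by (rule sets.countable_UN') (use sets_le in auto)
  have lim: "(\<lambda>n. measure \<mu> (U n)) \<longlonglongrightarrow> measure \<mu> (\<Inter>n. U n)"
  proof (rule finite_Lim_measure_decseq)
    show "decseq U" unfolding decseq_def U_def by (intro allI impI UN_mono) auto
  qed (use U in auto)
  have "t n \<le> measure \<mu> (U n)" for n
    by (rule order_trans[OF ge finite_measure_mono]) (use U in \<open>auto simp: U_def\<close>)
  then have "t' \<le> measure \<mu> (\<Inter>n. U n)"
    by (intro LIMSEQ_le[OF t lim]) auto
  also have "\<dots> \<le> measure \<mu> {y. a' \<bullet> y \<le> b'}"
  proof (rule finite_measure_mono)
    show "(\<Inter>n. U n) \<subseteq> {y. a' \<bullet> y \<le> b'}"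
    proof
      fix y assume "y \<in> (\<Inter>n. U n)"
      then have *: "\<exists>m\<ge>n. a m \<bullet> y \<le> b m" for n by (auto simp: U_def)
      show "y \<in> {y. a' \<bullet> y \<le> b'}"
      proof (rule ccontr)
        assume "\<not> ?thesis"
        then have "a' \<bullet> y - b' > 0" by simp
        moreover have "(\<lambda>n. a n \<bullet> y - b n) \<longlonglongrightarrow> a' \<bullet> y - b'" by (intro tendsto_intros a b)
        ultimately have "eventually (\<lambda>n. a n \<bullet> y - b n > 0) sequentially" by (rule order_tendstoD(1)[rotated])
        then obtain n where "\<And>m. m \<ge> n \<Longrightarrow> a m \<bullet> y - b m > 0" by (auto simp: eventually_sequentially)
        then show False using *[of n] by fastforce
      qed
    qed
  qed (rule sets_le)
  finally show ?thesis .
qed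

text \<open>Upper semicontinuity applied to the opposite halfspaces; their common boundary is a null
  set, by absolute continuity and because the limiting normal is nonzero.\<close>

lemma measure_halfspace_lsc:
  fixes \<mu> :: "'a::euclidean_space measure"
  assumes "prob_space \<mu>" and sets: "sets \<mu> = sets borel" and ac: "absolutely_continuous lborel \<mu>"
    and a: "a \<longlonglongrightarrow> a'" "a' \<noteq> 0" and b: "b \<longlonglongrightarrow> b'"
    and le: "\<And>n::nat. measure \<mu> {y. a n \<bullet> y \<le> b n} \<le> t"
  shows "measure \<mu> {y. a' \<bullet> y \<le> b'} \<le> t"
proof -
  interpret prob_space \<mu> by fact
  have sp: "space \<mu> = UNIV" using sets by (metis sets_eq_imp_space_eq space_borel)
  have sets_le: "{y. a \<bullet> y \<le> b} \<in> sets \<mu>" "{y. a \<bullet> y > b} \<in> sets \<mu>" "{y. a \<bullet> y \<ge> b} \<in> sets \<mu>" for a :: 'a and b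
    unfolding sets by (auto intro!: borel_closed borel_open closed_halfspace_le open_halfspace_gt closed_halfspace_ge)
  have compl: "measure \<mu> {y. a \<bullet> y > b} = 1 - measure \<mu> {y. a \<bullet> y \<le> b}" for a :: 'a and b
  proof -
    have "{y. a \<bullet> y > b} = space \<mu> - {y. a \<bullet> y \<le> b}" by (auto simp: sp)
    then show ?thesis using prob_compl[OF sets_le(1)[of a b]] by simp
  qed
  have "measure \<mu> {y. (- a') \<bullet> y \<le> - b'} \<ge> 1 - t"
  proof (rule measure_halfspace_usc[OF finite_measure_axioms sets])
    show "(\<lambda>n. - a n) \<longlonglongrightarrow> - a'" "(\<lambda>n. - b n) \<longlonglongrightarrow> - b'" "(\<lambda>n. 1 - t) \<longlonglongrightarrow> 1 - t"
      by (intro tendsto_intros a b)+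
    fix n
    have "1 - t \<le> measure \<mu> {y. a n \<bullet> y > b n}" using le[of n] compl by simp
    also have "\<dots> \<le> measure \<mu> {y. a n \<bullet> y \<ge> b n}" by (rule finite_measure_mono) (use sets_le in auto)
    finally show "1 - t \<le> measure \<mu> {y. (- a n) \<bullet> y \<le> - b n}" by simp
  qed
  then have "1 - t \<le> measure \<mu> {y. a' \<bullet> y \<ge> b'}" by simp
  also have "measure \<mu> {y. a' \<bullet> y \<ge> b'} = measure \<mu> {y. a' \<bullet> y > b'}"
  proof -
    have "{y. a' \<bullet> y = b'} \<in> null_sets (completion lborel)"
      using negligible_hyperplane[of a' b'] a(2) by (simp add: negligible_iff_null_sets)
    then have "{y. a' \<bullet> y = b'} \<in> null_sets lborel"
      by (subst (asm) null_sets_completion_iff) (auto intro: borel_closed closed_hyperplane)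
    then have null: "{y. a' \<bullet> y = b'} \<in> null_sets \<mu>" using ac by (auto simp: absolutely_continuous_def)
    have "{y. a' \<bullet> y \<ge> b'} = {y. a' \<bullet> y > b'} \<union> {y. a' \<bullet> y = b'}" by auto
    then show ?thesis using measure_Un_null_set[OF sets_le(2) null] by simp
  qed
  finally show ?thesis using compl by simp
qed

definition annihilator :: "('d \<Rightarrow> nat) \<Rightarrow> nat \<Rightarrow> complex ^ 'd ^ 'd \<Rightarrow> (complex ^ 'd) set" where
  "annihilator \<rho> i v = {a. \<forall>j. \<rho> j < i \<longrightarrow> cinner a (v $ j) = 0}"

lemma inner_eq_Re_cinner: "x \<bullet> y = Re (cinner x y)"
  by (simp add: inner_vec_def cinner_def inner_complex_def)

lemma cinner_mult_right: "cinner x (c *s y) = cnj c * cinner x y"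
  by (simp add: cinner_def sum_distrib_left algebra_simps)

lemma cinner_mult_left: "cinner (c *s x) y = c * cinner x y"
  by (simp add: cinner_def sum_distrib_left algebra_simps)

lemma cinner_add_left: "cinner (x + y) z = cinner x z + cinner y z"
  by (simp add: cinner_def sum.distrib algebra_simps)

lemma subspace_annihilator: "subspace (annihilator \<rho> i v)"
  by (auto simp: subspace_def annihilator_def cinner_add_left cinner_scaleR_left) (simp add: cinner_def)

text \<open>Over the reals the vectors \<open>v $ j\<close> and their multiples by the imaginary
  unit form an orthonormal system, so each row removes two dimensions.\<close>

lemma dim_annihilator:
  fixes v :: "complex ^ 'd ^ 'd"
  assumes v: "unitary_frame v" and \<rho>: "bij_betw \<rho> UNIV {..<CARD('d)}" and i: "i \<le> CARD('d)"
  shows "dim (annihilator \<rho> i v) = 2 * (CARD('d) - i)"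
proof -
  define J where "J = {j. \<rho> j < i}"
  have cardJ: "card J = i" unfolding J_def by (rule card_rows_below[OF \<rho> i])
  have vv: "cinner (v $ j) (v $ k) = of_bool (j = k)" for j k
    using v by (simp add: unitary_frame_def)
  define g where "g = (\<lambda>(j, b). if b then \<i> *s (v $ j) else v $ j)"
  have g: "g p \<bullet> g p' = of_bool (p = p')" for p p'
    by (cases p; cases p') (auto simp: g_def inner_eq_Re_cinner cinner_mult_left cinner_mult_right vv)
  have injg: "inj g" by (rule injI) (metis g of_bool_eq_1_iff)
  let ?W = "g ` (J \<times> UNIV)"
  have "g p \<noteq> 0" for p using g[of p p] by auto
  then have "independent ?W"
    by (intro pairwise_orthogonal_independent) (auto simp: pairwise_def orthogonal_def g, metis)
  then have dimW: "dim (span ?W) = 2 * i"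
    using card_image[OF inj_on_subset[OF injg, of "J \<times> UNIV"]] cardJ
    by (simp add: dim_eq_card_independent card_cartesian_product)
  have "cinner a (v $ j) = 0 \<longleftrightarrow> (\<forall>b. g (j, b) \<bullet> a = 0)" for a j
  proof -
    have "g (j, b) \<bullet> a = Re (cinner a (g (j, b)))" for b
      by (subst inner_commute) (rule inner_eq_Re_cinner)
    then show ?thesis by (auto simp: g_def cinner_mult_right complex_eq_iff all_bool_eq)
  qed
  then have "annihilator \<rho> i v = {a. \<forall>x\<in>?W. orthogonal x a}"
    by (auto simp: annihilator_def J_def orthogonal_def)
  also have "\<dots> = {a\<in>UNIV. \<forall>x\<in>span ?W. orthogonal x a}"
  proof (intro Collect_cong iffI conjI ballI UNIV_I)
    fix a x assume a: "\<forall>x\<in>?W. orthogonal x a" and x: "x \<in> span ?W"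
    have "orthogonal a x"
      by (rule orthogonal_to_span[OF x]) (use a orthogonal_commute in blast)
    then show "orthogonal x a" by (simp add: orthogonal_commute)
  qed (use span_base[of _ ?W] in blast)
  also have "dim \<dots> + dim (span ?W) = dim (UNIV :: (complex ^ 'd) set)"
    by (rule dim_subspace_orthogonal_to_vectors) auto
  finally show ?thesis using dimW by simp
qed

section \<open>Continuous selection of deep points\<close>

text \<open>The conjugate transpose is a right inverse of the frame matrix, hence also a left
  inverse, so the columns are orthonormal as well.\<close>

lemma cinner_parseval:
  fixes v :: "complex ^ 'd ^ 'd"
  assumes "unitary_frame v"
  shows "cinner x y = (\<Sum>j\<in>UNIV. cinner x (v $ j) * cnj (cinner y (v $ j)))"
proof -
  define V where "V = (\<chi> k j. cnj (v $ j $ k))"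
  have "v ** V = mat 1"
    using assms by (simp add: V_def matrix_matrix_mult_def mat_def vec_eq_iff unitary_frame_def cinner_def)
  then have "V ** v = mat 1" by (rule matrix_left_right_inverse[THEN iffD1])
  then have V: "(\<Sum>j\<in>UNIV. cnj (v $ j $ k) * v $ j $ l) = of_bool (k = l)" for k l
    by (simp add: V_def matrix_matrix_mult_def mat_def vec_eq_iff)
  have "(\<Sum>j\<in>UNIV. cinner x (v $ j) * cnj (cinner y (v $ j))) =
      (\<Sum>j\<in>UNIV. \<Sum>k\<in>UNIV. \<Sum>l\<in>UNIV. x $ k * cnj (y $ l) * (cnj (v $ j $ k) * v $ j $ l))"
    by (simp add: cinner_def sum_product mult_ac)
  also have "\<dots> = (\<Sum>k\<in>UNIV. \<Sum>l\<in>UNIV. x $ k * cnj (y $ l) * (\<Sum>j\<in>UNIV. cnj (v $ j $ k) * v $ j $ l))"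
    unfolding sum_distrib_left
    by (subst sum.swap, rule sum.cong[OF refl], subst sum.swap, rule refl)
  also have "\<dots> = cinner x y" by (simp add: V cinner_def)
  finally show ?thesis by simp
qed

lemma compact_unitary_frames: "compact {v :: complex ^ 'd ^ 'd. unitary_frame v}"
proof -
  have "closed {v :: complex ^ 'd ^ 'd. unitary_frame v}"
    unfolding unitary_frame_def
    by (intro closed_Collect_all closed_Collect_eq continuous_intros)
  moreover have "bounded {v :: complex ^ 'd ^ 'd. unitary_frame v}"
    unfolding bounded_iff
  proof (intro exI ballI)
    fix v :: "complex ^ 'd ^ 'd" assume "v \<in> {v. unitary_frame v}"
    then have "complex_of_real ((norm (v $ r))\<^sup>2) = complex_of_real 1" for r
      using cinner_self[of "v $ r"] by (simp add: unitary_frame_def)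
    then have "norm (v $ r) = 1" for r
      unfolding of_real_eq_iff by (metis norm_ge_zero power2_eq_1_iff le_minus_one_simps(3))
    then show "norm v \<le> CARD('d)"
      using L2_set_le_sum[of UNIV "\<lambda>r. norm (v $ r)"] by (simp add: norm_vec_def)
  qed
  ultimately show ?thesis by (simp add: compact_eq_bounded_closed)
qed

text \<open>Halfspace depth is quasiconcave: the halfspace through an average contains the parallel
  one through some point of positive weight. Convex combinations of deep points therefore stay
  deep.\<close>

lemma ex_term_le_average:
  fixes x :: "'i \<Rightarrow> 'a::real_inner"
  assumes "finite I" "\<And>i. i \<in> I \<Longrightarrow> w i \<ge> 0" "sum w I = 1"
  shows "\<exists>i\<in>I. w i > 0 \<and> a \<bullet> x i \<le> a \<bullet> (\<Sum>i\<in>I. w i *\<^sub>R x i)"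
proof (rule ccontr)
  let ?m = "a \<bullet> (\<Sum>i\<in>I. w i *\<^sub>R x i)"
  assume *: "\<not> ?thesis"
  obtain i where i: "i \<in> I" "w i > 0"
    using assms by (metis less_eq_real_def sum.neutral zero_neq_one)
  have "(\<Sum>i\<in>I. w i * ?m) < (\<Sum>i\<in>I. w i * (a \<bullet> x i))"
  proof (rule sum_strict_mono_ex1[OF assms(1)])
    show "\<exists>i\<in>I. w i * ?m < w i * (a \<bullet> x i)" using * i by (intro bexI[of _ i]) auto
    show "\<forall>j\<in>I. w j * ?m \<le> w j * (a \<bullet> x j)"
    proof
      fix j assume "j \<in> I"
      then show "w j * ?m \<le> w j * (a \<bullet> x j)"
        using * assms(2)[of j] by (cases "w j = 0") auto
    qed
  qed
  then show False using assms(3) by (simp add: inner_sum_right sum_distrib_right[symmetric])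
qed

definition negate_rows :: "('r \<Rightarrow> bool) \<Rightarrow> 'a::uminus ^ 'r \<Rightarrow> 'a ^ 'r" where
  "negate_rows \<epsilon> v = (\<chi> r. if \<epsilon> r then - v $ r else v $ r)"

lemma negate_rows_negate_row:
  fixes v :: "'a::group_add ^ 'r"
  shows "negate_rows \<epsilon> (negate_row r v) = negate_rows (\<epsilon>(r := \<not> \<epsilon> r)) v"
  by (auto simp: negate_rows_def negate_row_def vec_eq_iff)

lemma unitary_frame_negate_rows: "unitary_frame v \<Longrightarrow> unitary_frame (negate_rows \<epsilon> v)"
  by (auto simp: unitary_frame_def negate_rows_def)

lemma annihilator_negate_rows: "annihilator \<rho> n (negate_rows \<epsilon> v) = annihilator \<rho> n v"
  by (auto simp: annihilator_def negate_rows_def)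

lemma continuous_on_negate_rows: 
  fixes \<epsilon> :: "'r::finite \<Rightarrow> bool"
  shows "continuous_on S (negate_rows \<epsilon> :: 'a::real_normed_vector ^ 'r \<Rightarrow> _)"
proof -
  have "continuous_on S (\<lambda>v :: 'a ^ 'r. if \<epsilon> r then - v $ r else v $ r)" for r
    by (cases "\<epsilon> r") (auto intro!: continuous_intros)
  then show ?thesis unfolding negate_rows_def by (rule continuous_on_vec_lambda)
qed

text \<open>Unit normals have a convergent subsequence, and shallowness passes to the limit by lower
  semicontinuity. Consequently a point deep for one frame is deep for all nearby frames.\<close>

lemma closed_shallow_frames:
  fixes \<mu> :: "(complex ^ 'd) measure"
  assumes \<mu>: "prob_space \<mu>" "sets \<mu> = sets borel" "absolutely_continuous lborel \<mu>"
  shows "closed {v. unitary_frame v \<and> (\<exists>a\<in>annihilator \<rho> n v. norm a = 1 \<and> measure \<mu> {y. a \<bullet> y \<le> a \<bullet> x} \<le> t)}"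
  unfolding closed_sequential_limits
proof (intro allI impI, elim conjE)
  fix V v assume V: "\<forall>m. V m \<in> {v. unitary_frame v \<and> (\<exists>a\<in>annihilator \<rho> n v. norm a = 1 \<and> measure \<mu> {y. a \<bullet> y \<le> a \<bullet> x} \<le> t)}"
    and lim: "V \<longlonglongrightarrow> v"
  have "\<forall>m. \<exists>a\<in>annihilator \<rho> n (V m). norm a = 1 \<and> measure \<mu> {y. a \<bullet> y \<le> a \<bullet> x} \<le> t" using V by blast
  then obtain A where A: "\<And>m. A m \<in> annihilator \<rho> n (V m)" "\<And>m. A m \<in> sphere 0 1"
    "\<And>m. measure \<mu> {y. A m \<bullet> y \<le> A m \<bullet> x} \<le> t" by (metis mem_sphere_0)
  have "compact (sphere 0 1 :: (complex ^ 'd) set)" by simp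
  then obtain a \<phi> where a: "a \<in> sphere 0 1" "strict_mono \<phi>" "(A \<circ> \<phi>) \<longlonglongrightarrow> a"
    using A(2) unfolding compact_def by meson
  have A\<phi>: "(\<lambda>m. A (\<phi> m)) \<longlonglongrightarrow> a" using a(3) by (simp add: o_def)
  have V\<phi>: "(\<lambda>m. V (\<phi> m)) \<longlonglongrightarrow> v" using LIMSEQ_subseq_LIMSEQ[OF lim a(2)] by (simp add: o_def)
  have "v \<in> {v. unitary_frame v}"
    by (rule closed_sequentially[OF compact_imp_closed[OF compact_unitary_frames] _ lim]) (use V in auto)
  moreover have "cinner a (v $ j) = 0" if "\<rho> j < n" for j
  proof -
    have "(\<lambda>m. cinner (A (\<phi> m)) (V (\<phi> m) $ j)) \<longlonglongrightarrow> cinner a (v $ j)"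
      unfolding cinner_def by (intro tendsto_intros A\<phi> V\<phi>)
    moreover have "cinner (A (\<phi> m)) (V (\<phi> m) $ j) = 0" for m using A(1) that by (auto simp: annihilator_def)
    ultimately show ?thesis by (simp add: LIMSEQ_const_iff)
  qed
  moreover have "measure \<mu> {y. a \<bullet> y \<le> a \<bullet> x} \<le> t"
    by (rule measure_halfspace_lsc[OF \<mu> A\<phi> _ _ A(3)]) (use a(1) in \<open>auto intro!: tendsto_intros A\<phi>\<close>)
  ultimately show "v \<in> {v. unitary_frame v \<and> (\<exists>a\<in>annihilator \<rho> n v. norm a = 1 \<and> measure \<mu> {y. a \<bullet> y \<le> a \<bullet> x} \<le> t)}"
    using a(1) by (auto simp: annihilator_def)
qed

text \<open>A centre for one frame loses less than \<open>e\<close> of its depth on a neighbourhood.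
  Finitely many such points suffice by compactness; a partition of unity blends them, and averaging
  over sign patterns makes the result invariant.\<close>

lemma ex_continuous_deep_point:
  fixes \<mu> :: "(complex ^ 'd) measure"
  assumes \<mu>: "prob_space \<mu>" "sets \<mu> = sets borel" "absolutely_continuous lborel \<mu>"
    and \<rho>: "bij_betw \<rho> UNIV {..<CARD('d)}" and n: "n \<le> CARD('d)" and e: "e > 0"
    and t: "t = 1 / real (2 * (CARD('d) - n) + 1)"
    and R: "measure \<mu> (cball 0 R) > 1 - t"
  shows "\<exists>p. continuous_on UNIV p \<and> (\<forall>r v. p (negate_row r v) = p v) \<and> (\<forall>v. norm (p v) \<le> R) \<and>
    (\<forall>v. unitary_frame v \<longrightarrow> (\<forall>a\<in>annihilator \<rho> n v. measure \<mu> {y. a \<bullet> y \<le> a \<bullet> p v} \<ge> t - e))"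
proof -
  interpret prob_space \<mu> by fact
  have sp: "space \<mu> = UNIV" using \<mu>(2) by (metis sets_eq_imp_space_eq space_borel)
  have sets_le: "{y. a \<bullet> y \<le> b} \<in> sets \<mu>" for a :: "complex ^ 'd" and b
    unfolding \<mu>(2) by (auto intro!: borel_closed closed_halfspace_le)
  define Bad where "Bad x = {v. unitary_frame v \<and> (\<exists>a\<in>annihilator \<rho> n v. norm a = 1 \<and> measure \<mu> {y. a \<bullet> y \<le> a \<bullet> x} \<le> t - e)}" for x
  have closed: "closed (Bad x)" for x unfolding Bad_def by (rule closed_shallow_frames[OF \<mu>])
  have t1: "t \<le> 1" unfolding t by simp
  have R0: "0 \<in> cball (0 :: complex ^ 'd) R"
  proof -
    have "measure \<mu> (cball 0 R) > 0" using R t1 by linarith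
    then have "cball (0 :: complex ^ 'd) R \<noteq> {}" by (metis less_irrefl measure_empty)
    then show ?thesis by (simp add: not_less)
  qed
  have ex: "\<exists>x\<in>cball 0 R. v \<notin> Bad x" if v: "unitary_frame v" for v
  proof -
    obtain x where "norm x \<le> R" "\<And>a. a \<in> annihilator \<rho> n v \<Longrightarrow> measure \<mu> {y. a \<bullet> y \<le> a \<bullet> x} \<ge> t"
      using center_point[OF \<mu>(1,2) subspace_annihilator[of \<rho> n v], of "2 * (CARD('d) - n)" R]
        dim_annihilator[OF v \<rho> n] R t by auto
    then show ?thesis using e by (intro bexI[of _ x]) (fastforce simp: Bad_def)+
  qed
  have opn: "open (- Bad x)" if "x \<in> cball 0 R" for x using closed by (rule open_Compl)
  have "{v. unitary_frame v} \<subseteq> (\<Union>x\<in>cball 0 R. - Bad x)" using ex by blast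
  from compactE_image[OF compact_unitary_frames opn this]
  obtain D where D: "D \<subseteq> cball 0 R" "finite D" "{v. unitary_frame v} \<subseteq> (\<Union>x\<in>D. - Bad x)"
    by blast
  \<comment> \<open>Every set \<open>- Bad x\<close> contains all matrices that are not unitary
    frames. Inserting 0 secures that they are covered without showing that \<open>D\<close> is
    nonempty.\<close>
  define C where "C = (\<lambda>x. - Bad x) ` insert 0 D"
  have C: "finite C" "UNIV \<subseteq> \<Union>C" "\<And>U. U \<in> C \<Longrightarrow> open U"
  proof -
    show "finite C" using D(2) by (simp add: C_def)
    show "open U" if "U \<in> C" for U using that closed open_Compl unfolding C_def by blast
    have "Bad x \<subseteq> {v. unitary_frame v}" for x by (auto simp: Bad_def)
    then show "UNIV \<subseteq> \<Union>C" using D(3) unfolding C_def by blast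
  qed
  have fin: "\<exists>V. open V \<and> x \<in> V \<and> finite {U \<in> C. U \<inter> V \<noteq> {}}" for x
    using C(1) by (intro exI[of _ UNIV]) auto
  obtain F where F: "\<And>U. U \<in> C \<Longrightarrow> continuous_on UNIV (F U) \<and> (\<forall>x\<in>UNIV. (0::real) \<le> F U x)"
      "\<And>x U. \<lbrakk>U \<in> C; x \<in> UNIV; x \<notin> U\<rbrakk> \<Longrightarrow> F U x = 0"
      "\<And>x. x \<in> UNIV \<Longrightarrow> supp_sum (\<lambda>W. F W x) C = 1"
    by (rule subordinate_partition_of_unity[OF C(2,3) fin]) blast+
  have Fsum: "(\<Sum>U\<in>C. F U x) = 1" for x
  proof -
    have "supp_sum (\<lambda>W. F W x) C = (\<Sum>U\<in>C. F U x)"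
      unfolding supp_sum_def support_on_def by (rule sum.mono_neutral_left) (use C(1) in auto)
    then show ?thesis using F(3) by simp
  qed
  have "\<forall>U\<in>C. \<exists>x\<in>cball 0 R. U = - Bad x" using D(1) R0 by (auto simp: C_def)
  then obtain c where c: "\<And>U. U \<in> C \<Longrightarrow> c U \<in> cball 0 R" "\<And>U. U \<in> C \<Longrightarrow> U = - Bad (c U)" by metis
  define p0 where "p0 v = (\<Sum>U\<in>C. F U v *\<^sub>R c U)" for v
  have p0R: "p0 v \<in> cball 0 R" for v
    unfolding p0_def by (intro convex_sum C(1) convex_cball Fsum c(1)) (use F(1) in auto)
  have p0c: "continuous_on UNIV p0"
    unfolding p0_def by (intro continuous_intros) (use F(1) in auto)
  have p0d: "measure \<mu> {y. a \<bullet> y \<le> a \<bullet> p0 v} \<ge> t - e" if v: "unitary_frame v" and a: "a \<in> annihilator \<rho> n v" for v a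
  proof (cases "a = 0")
    case True
    then show ?thesis using t1 e prob_space sp by simp
  next
    case False
    obtain U where U: "U \<in> C" "F U v > 0" "a \<bullet> c U \<le> a \<bullet> p0 v"
      using ex_term_le_average[OF C(1) _ Fsum[of v], of a c] F(1) unfolding p0_def by auto
    then have "v \<notin> Bad (c U)" using F(2)[of U v] c(2) by auto
    moreover define b where "b = (1 / norm a) *\<^sub>R a"
    moreover have "b \<in> annihilator \<rho> n v" "norm b = 1"
      using False a by (auto simp: b_def annihilator_def cinner_scaleR_left)
    ultimately have "measure \<mu> {y. b \<bullet> y \<le> b \<bullet> c U} > t - e" using v by (auto simp: Bad_def)
    moreover have "{y. b \<bullet> y \<le> b \<bullet> c U} = {y. a \<bullet> y \<le> a \<bullet> c U}"
      using False by (simp add: b_def divide_le_cancel)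
    ultimately have "t - e \<le> measure \<mu> {y. a \<bullet> y \<le> a \<bullet> c U}" by simp
    also have "\<dots> \<le> measure \<mu> {y. a \<bullet> y \<le> a \<bullet> p0 v}"
      by (rule finite_measure_mono[OF _ sets_le]) (use U(3) in auto)
    finally show ?thesis .
  qed
  define N where "N = real CARD('d \<Rightarrow> bool)"
  have N: "N > 0" "(\<Sum>\<epsilon>\<in>(UNIV :: ('d \<Rightarrow> bool) set). 1 / N) = 1" by (auto simp: N_def)
  \<comment> \<open>The average over all sign patterns of the rows. Each term is deep for the same
    normals, because annihilators ignore signs.\<close>
  define p where "p v = (\<Sum>\<epsilon>\<in>(UNIV :: ('d \<Rightarrow> bool) set). (1 / N) *\<^sub>R p0 (negate_rows \<epsilon> v))" for v
  show ?thesis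
  proof (intro exI[of _ p] conjI allI impI ballI)
    show "continuous_on UNIV p"
      unfolding p_def
      by (intro continuous_intros continuous_on_compose2[OF p0c continuous_on_negate_rows]) auto
    show "p (negate_row r v) = p v" for r v
      unfolding p_def negate_rows_negate_row
      by (rule sum.reindex_bij_witness[of _ "\<lambda>\<epsilon>. \<epsilon>(r := \<not> \<epsilon> r)" "\<lambda>\<epsilon>. \<epsilon>(r := \<not> \<epsilon> r)"]) auto
    have "p v \<in> cball 0 R" for v
      unfolding p_def by (intro convex_sum convex_cball N p0R) (use N in auto)
    then show "norm (p v) \<le> R" for v by simp
    fix v a assume v: "unitary_frame v" and a: "a \<in> annihilator \<rho> n v"
    obtain \<epsilon> where \<epsilon>: "a \<bullet> p0 (negate_rows \<epsilon> v) \<le> a \<bullet> p v"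
      using ex_term_le_average[OF _ _ N(2), of a "\<lambda>\<epsilon>. p0 (negate_rows \<epsilon> v)"] N(1) unfolding p_def by auto
    have "t - e \<le> measure \<mu> {y. a \<bullet> y \<le> a \<bullet> p0 (negate_rows \<epsilon> v)}"
      by (rule p0d) (use v a in \<open>auto simp: unitary_frame_negate_rows annihilator_negate_rows\<close>)
    also have "\<dots> \<le> measure \<mu> {y. a \<bullet> y \<le> a \<bullet> p v}"
      by (rule finite_measure_mono[OF _ sets_le]) (use \<epsilon> in auto)
    finally show "t - e \<le> measure \<mu> {y. a \<bullet> y \<le> a \<bullet> p v}" .
  qed
qed

section \<open>Flags of central transversals\<close>

lemma ex_frame_and_deep_point:
  fixes \<mu> :: "nat \<Rightarrow> (complex ^ 'd) measure" and n :: "nat \<Rightarrow> nat"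
  assumes \<mu>: "\<And>i. i < CARD('d) \<Longrightarrow> prob_space (\<mu> i)" "\<And>i. i < CARD('d) \<Longrightarrow> sets (\<mu> i) = sets borel"
    "\<And>i. i < CARD('d) \<Longrightarrow> absolutely_continuous lborel (\<mu> i)"
    and \<rho>: "bij_betw \<rho> UNIV {..<CARD('d)}" and n: "\<And>i. i < CARD('d) \<Longrightarrow> i \<le> n i \<and> n i \<le> CARD('d)"
    and t: "\<And>i. t i = 1 / real (2 * (CARD('d) - n i) + 1)"
    and R: "\<And>i. i < CARD('d) \<Longrightarrow> measure (\<mu> i) (cball 0 R) > 1 - t i" and e: "e > 0"
  shows "\<exists>v p. unitary_frame v \<and> norm p \<le> R \<and>
    (\<forall>i<CARD('d). \<forall>a\<in>annihilator \<rho> (n i) v. measure (\<mu> i) {y. a \<bullet> y \<le> a \<bullet> p} \<ge> t i - e)"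
proof -
  have "\<exists>p. continuous_on UNIV p \<and> (\<forall>r v. p (negate_row r v) = p v) \<and> (\<forall>v. norm (p v) \<le> R) \<and>
    (\<forall>v. unitary_frame v \<longrightarrow> (\<forall>a\<in>annihilator \<rho> (n i) v. measure (\<mu> i) {y. a \<bullet> y \<le> a \<bullet> p v} \<ge> t i - e))"
    if i: "i < CARD('d)" for i
    using n[OF i] by (intro ex_continuous_deep_point \<mu>[OF i] \<rho> R[OF i] t e) auto
  then obtain p where p: "\<And>i. i < CARD('d) \<Longrightarrow> continuous_on UNIV (p i)"
    "\<And>i r v. i < CARD('d) \<Longrightarrow> p i (negate_row r v) = p i v" "\<And>i v. i < CARD('d) \<Longrightarrow> norm (p i v) \<le> R"
    "\<And>i v a. i < CARD('d) \<Longrightarrow> unitary_frame v \<Longrightarrow> a \<in> annihilator \<rho> (n i) v \<Longrightarrow>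
      measure (\<mu> i) {y. a \<bullet> y \<le> a \<bullet> p i v} \<ge> t i - e"
    by metis
  have d0: "0 < CARD('d)" by simp
  \<comment> \<open>Taking the point of measure 0 as reference makes the condition for index 0
    empty, which is why the incidences start at 1.\<close>
  define q where "q i v = (if i < CARD('d) then p i v - p 0 v else 0)" for i v
  have qc: "continuous_on UNIV (q i)" for i
    unfolding q_def using p(1) d0 by (cases "i < CARD('d)") (auto intro!: continuous_intros)
  have qn: "q i (negate_row r v) = q i v" for i r v
    unfolding q_def using p(2) d0 by auto
  obtain v where v: "unitary_frame v" "\<And>i j. 1 \<le> i \<Longrightarrow> i \<le> \<rho> j \<Longrightarrow> cinner (q i v) (v $ j) = 0"
    using ex_unitary_frame_orthogonal[of q, OF qc qn \<rho>] by blast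
  have "t i - e \<le> measure (\<mu> i) {y. a \<bullet> y \<le> a \<bullet> p 0 v}"
    if i: "i < CARD('d)" and a: "a \<in> annihilator \<rho> (n i) v" for i a
  proof -
    have "a \<bullet> p i v = a \<bullet> p 0 v"
    proof (cases "i = 0")
      case False
      \<comment> \<open>The normal \<open>a\<close> has no component along rows of rank below
        \<open>n i\<close>, and \<open>q i v\<close> has none along rows of rank at least
        \<open>i\<close>. As \<open>i \<le> n i\<close>, no row is left, and Parseval gives
        orthogonality.\<close>
      have "cinner a (v $ j) = 0 \<or> cinner (q i v) (v $ j) = 0" for j
        using a v(2)[of i j] n[OF i] False unfolding annihilator_def by (cases "i \<le> \<rho> j") auto
      then have "cinner a (q i v) = 0"
        by (subst cinner_parseval[OF v(1)]) (auto intro!: sum.neutral)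
      then have "a \<bullet> q i v = 0" by (simp add: inner_eq_Re_cinner)
      then show ?thesis using i by (simp add: q_def inner_diff_right)
    qed simp
    then show ?thesis using p(4)[OF i v(1) a] by simp
  qed
  then show ?thesis using v(1) p(3)[OF d0] by blast
qed

text \<open>Subtracting from \<open>a\<close> its components along the relevant rows of
  \<open>V m\<close> gives normals converging to \<open>a\<close>, so depth at the approximating
  frames can be compared with depth in the direction \<open>a\<close>.\<close>

lemma annihilator_approximation:
  assumes v: "unitary_frame v" "\<And>m. unitary_frame (V m)" and lim: "V \<longlonglongrightarrow> v" and a: "a \<in> annihilator \<rho> n v"
  obtains A where "\<And>m. A m \<in> annihilator \<rho> n (V m)" "A \<longlonglongrightarrow> a"
proof
  let ?A = "\<lambda>m. a - (\<Sum>j\<in>{j. \<rho> j < n}. cinner a (V m $ j) *s (V m $ j))"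
  have diff: "cinner (x - y) z = cinner x z - cinner y z" for x y z :: "complex ^ 'a"
    by (simp add: cinner_def sum_subtractf algebra_simps)
  have "cinner (?A m) (V m $ l) = 0" if "\<rho> l < n" for m l
  proof -
    have "cinner (?A m) (V m $ l) = cinner a (V m $ l) - (\<Sum>j\<in>{j. \<rho> j < n}. cinner a (V m $ j) * of_bool (j = l))"
      using v(2)[of m] by (simp add: diff cinner_sum_left cinner_mult_left unitary_frame_def)
    also have "\<dots> = 0" using that by (simp add: of_bool_def if_distrib sum.delta cong: if_cong)
    finally show ?thesis .
  qed
  then show "?A m \<in> annihilator \<rho> n (V m)" for m by (simp add: annihilator_def)
  have "?A \<longlonglongrightarrow> a - (\<Sum>j\<in>{j. \<rho> j < n}. cinner a (v $ j) *s (v $ j))"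
    unfolding cinner_def vector_scalar_mult_def
    by (intro tendsto_intros lim)
  moreover have "(\<Sum>j\<in>{j. \<rho> j < n}. cinner a (v $ j) *s (v $ j)) = 0"
    using a by (intro sum.neutral) (auto simp: annihilator_def)
  ultimately show "?A \<longlonglongrightarrow> a" by simp
qed

lemma ex_frame_and_center_point:
  fixes \<mu> :: "nat \<Rightarrow> (complex ^ 'd) measure" and n :: "nat \<Rightarrow> nat"
  assumes \<mu>: "\<And>i. i < CARD('d) \<Longrightarrow> prob_space (\<mu> i)" "\<And>i. i < CARD('d) \<Longrightarrow> sets (\<mu> i) = sets borel"
    "\<And>i. i < CARD('d) \<Longrightarrow> absolutely_continuous lborel (\<mu> i)"
    and \<rho>: "bij_betw \<rho> UNIV {..<CARD('d)}" and n: "\<And>i. i < CARD('d) \<Longrightarrow> i \<le> n i \<and> n i \<le> CARD('d)"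
  shows "\<exists>v p. unitary_frame v \<and>
    (\<forall>i<CARD('d). \<forall>a\<in>annihilator \<rho> (n i) v. measure (\<mu> i) {y. a \<bullet> y \<le> a \<bullet> p} \<ge> 1 / real (2 * (CARD('d) - n i) + 1))"
proof -
  define t where "t i = 1 / real (2 * (CARD('d) - n i) + 1)" for i
  have "\<forall>i\<in>{..<CARD('d)}. eventually (\<lambda>m. measure (\<mu> i) (cball 0 (real m)) > 1 - t i) sequentially"
  proof
    fix i assume "i \<in> {..<CARD('d)}"
    then have i: "i < CARD('d)" by simp
    interpret prob_space "\<mu> i" by (rule \<mu>(1)[OF i])
    have sp: "space (\<mu> i) = UNIV" using \<mu>(2)[OF i] by (metis sets_eq_imp_space_eq space_borel)
    have "(\<lambda>m. measure (\<mu> i) (cball 0 (real m))) \<longlonglongrightarrow> measure (\<mu> i) (\<Union>m. cball 0 (real m))"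
      by (rule finite_Lim_measure_incseq) (auto simp: \<mu>(2)[OF i] incseq_def)
    moreover have "(\<Union>m. cball 0 (real m)) = space (\<mu> i)"
      unfolding sp by (auto simp: real_arch_simple)
    ultimately have "(\<lambda>m. measure (\<mu> i) (cball 0 (real m))) \<longlonglongrightarrow> 1" by (simp add: prob_space)
    then show "eventually (\<lambda>m. measure (\<mu> i) (cball 0 (real m)) > 1 - t i) sequentially"
      by (rule order_tendstoD) (simp add: t_def)
  qed
  \<comment> \<open>One radius for all of the finitely many measures, fixed before the loss of depth
    tends to zero; it keeps the points in a compact ball.\<close>
  then have "eventually (\<lambda>m. \<forall>i\<in>{..<CARD('d)}. measure (\<mu> i) (cball 0 (real m)) > 1 - t i) sequentially"
    by (intro eventually_ball_finite) auto
  then obtain R where R: "\<And>i. i < CARD('d) \<Longrightarrow> measure (\<mu> i) (cball 0 R) > 1 - t i"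
    by (auto simp: eventually_sequentially)
  have "\<exists>v p. unitary_frame v \<and> norm p \<le> R \<and> (\<forall>i<CARD('d). \<forall>a\<in>annihilator \<rho> (n i) v.
      measure (\<mu> i) {y. a \<bullet> y \<le> a \<bullet> p} \<ge> t i - 1 / real (Suc m))" for m
    by (rule ex_frame_and_deep_point[OF \<mu> \<rho> n t_def R]) auto
  then obtain V P where V: "\<And>m. unitary_frame (V m)" and P: "\<And>m. norm (P m) \<le> R"
    and VP: "\<And>m i a. i < CARD('d) \<Longrightarrow> a \<in> annihilator \<rho> (n i) (V m) \<Longrightarrow>
      measure (\<mu> i) {y. a \<bullet> y \<le> a \<bullet> P m} \<ge> t i - 1 / real (Suc m)" by metis
  have "compact ({v :: complex ^ 'd ^ 'd. unitary_frame v} \<times> cball (0 :: complex ^ 'd) R)"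
    by (intro compact_Times compact_unitary_frames compact_cball)
  moreover have "\<forall>m. (V m, P m) \<in> {v. unitary_frame v} \<times> cball 0 R" using V P by simp
  ultimately obtain vp \<phi> where vp: "vp \<in> {v. unitary_frame v} \<times> cball 0 R" "strict_mono \<phi>"
    "((\<lambda>m. (V m, P m)) \<circ> \<phi>) \<longlonglongrightarrow> vp"
    unfolding compact_def by meson
  obtain v p where vp_eq: "vp = (v, p)" by (cases vp)
  have v: "unitary_frame v" using vp(1) vp_eq by simp
  have limV: "(\<lambda>m. V (\<phi> m)) \<longlonglongrightarrow> v" and limP: "(\<lambda>m. P (\<phi> m)) \<longlonglongrightarrow> p"
    using tendsto_fst[OF vp(3)] tendsto_snd[OF vp(3)] by (simp_all add: o_def vp_eq)
  have lim0: "(\<lambda>m. t i - 1 / real (Suc (\<phi> m))) \<longlonglongrightarrow> t i" for i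
  proof -
    have "(\<lambda>m. t i - 1 / real (Suc m)) \<longlonglongrightarrow> t i - 0"
      by (intro tendsto_diff tendsto_const LIMSEQ_Suc lim_1_over_n)
    then show ?thesis using LIMSEQ_subseq_LIMSEQ[OF _ vp(2)] by (simp add: o_def)
  qed
  have "t i \<le> measure (\<mu> i) {y. a \<bullet> y \<le> a \<bullet> p}"
    if i: "i < CARD('d)" and a: "a \<in> annihilator \<rho> (n i) v" for i a
  proof -
    obtain A where A: "\<And>m. A m \<in> annihilator \<rho> (n i) (V (\<phi> m))" "A \<longlonglongrightarrow> a"
      using annihilator_approximation[OF v V limV a] by blast
    show ?thesis
    proof (rule measure_halfspace_usc[OF _ \<mu>(2)[OF i] A(2) _ lim0[of i]])
      show "finite_measure (\<mu> i)" using \<mu>(1)[OF i] by (rule prob_space.finite_measure)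
      show "(\<lambda>m. A m \<bullet> P (\<phi> m)) \<longlonglongrightarrow> a \<bullet> p" by (intro tendsto_intros A(2) limP)
      show "t i - 1 / real (Suc (\<phi> m)) \<le> measure (\<mu> i) {y. A m \<bullet> y \<le> A m \<bullet> P (\<phi> m)}" for m
        by (rule VP[OF i A(1)])
    qed
  qed
  then show ?thesis using v unfolding t_def by blast
qed

lemma complex_dim_span_frame:
  fixes v :: "complex ^ 'd ^ 'd"
  assumes v: "unitary_frame v" and \<rho>: "bij_betw \<rho> UNIV {..<CARD('d)}" and i: "i \<le> CARD('d)"
  shows "vec.dim (vec.span (($) v ` {j. \<rho> j < i})) = i"
proof -
  let ?J = "{j. \<rho> j < i}"
  have vv: "cinner (v $ j) (v $ k) = of_bool (j = k)" for j k
    using v by (simp add: unitary_frame_def)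
  have inj: "inj (($) v)"
    by (rule injI) (metis vv of_bool_eq_1_iff)
  have card: "card (($) v ` ?J) = i"
    using card_image[OF inj_on_subset[OF inj, of ?J]] card_rows_below[OF \<rho> i] by simp
  have "vec.independent (($) v ` ?J)"
  proof (rule vec.independent_if_scalars_zero)
    fix f x assume s: "(\<Sum>x\<in>($) v ` ?J. f x *s x) = 0" and x: "x \<in> ($) v ` ?J"
    have "0 = cinner (\<Sum>x\<in>($) v ` ?J. f x *s x) x" unfolding s by (simp add: cinner_def)
    also have "\<dots> = (\<Sum>y\<in>($) v ` ?J. f y * cinner y x)" by (simp add: cinner_sum_left cinner_mult_left)
    also have "\<dots> = (\<Sum>y\<in>($) v ` ?J. if y = x then f y else 0)"
      using x inj by (intro sum.cong) (auto simp: vv dest: injD)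
    also have "\<dots> = f x" using x by (subst sum.delta) auto
    finally show "f x = 0" by simp
  qed auto
  then show ?thesis using vec.dim_span_eq_card_independent card by metis
qed

text \<open>Along a complex line in the flat the real functional can be increased without bound
  unless the Hermitian product vanishes. Hence real halfspaces containing a complex flat have
  normals in the complex orthogonal complement.\<close>

lemma normal_in_annihilator:
  assumes sub: "(\<lambda>w. p + w) ` vec.span (($) v ` {j. \<rho> j < n}) \<subseteq> {x. a \<bullet> x \<le> b}"
  shows "a \<in> annihilator \<rho> n v" "a \<bullet> p \<le> b"
proof -
  have le: "a \<bullet> (p + w) \<le> b" if "w \<in> vec.span (($) v ` {j. \<rho> j < n})" for w
    using sub that by blast
  show "a \<bullet> p \<le> b" using le[OF vec.span_zero] by simp
  have "cinner a (v $ j) = 0" if j: "\<rho> j < n" for j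
  proof (rule ccontr)
    let ?z = "cinner a (v $ j)"
    assume nz: "?z \<noteq> 0"
    \<comment> \<open>Together with the phase of \<open>?z\<close>, this length raises the
      functional from its value at \<open>p\<close> to exactly \<open>b + 1\<close>.\<close>
    define s where "s = (b - a \<bullet> p + 1) / (cmod ?z)\<^sup>2"
    define c where "c = complex_of_real s * ?z"
    have "c *s (v $ j) \<in> vec.span (($) v ` {j. \<rho> j < n})"
      using j by (intro vec.span_scale vec.span_base) auto
    then have "a \<bullet> (p + c *s (v $ j)) \<le> b" by (rule le)
    moreover have "a \<bullet> (c *s (v $ j)) = Re (complex_of_real s * (?z * cnj ?z))"
      by (simp add: inner_eq_Re_cinner[of a] cinner_mult_right c_def mult_ac)
    moreover have "\<dots> = s * (cmod ?z)\<^sup>2"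
      by (simp add: complex_norm_square[symmetric] del: of_real_power)
    moreover have "\<dots> = b - a \<bullet> p + 1" using nz by (simp add: s_def)
    ultimately show False by (simp add: inner_add_right)
  qed
  then show "a \<in> annihilator \<rho> n v" by (simp add: annihilator_def)
qed

theorem theorem3p1:
  fixes \<mu> :: "nat \<Rightarrow> (complex ^ 'd) measure" and k :: nat
  assumes "k < CARD('d)"
    and "\<And>i. i < CARD('d) \<Longrightarrow> prob_space (\<mu> i)"
    and "\<And>i. i < CARD('d) \<Longrightarrow> sets (\<mu> i) = sets borel"
    and "\<And>i. i < CARD('d) \<Longrightarrow> absolutely_continuous lborel (\<mu> i)"
  shows "\<exists>V :: nat \<Rightarrow> (complex ^ 'd) set.
    (\<forall>i. k \<le> i \<and> i < CARD('d) \<longrightarrow> complex_affine_subspace i (V i)) \<and>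
    (\<forall>i. k \<le> i \<and> Suc i < CARD('d) \<longrightarrow> V i \<subseteq> V (Suc i)) \<and>
    (\<forall>i \<le> k. complex_central_transversal (\<mu> i) k (V k)) \<and>
    (\<forall>i. k < i \<and> i < CARD('d) \<longrightarrow> complex_central_transversal (\<mu> i) i (V i))"
proof -
  obtain \<rho> :: "'d \<Rightarrow> nat" where \<rho>: "bij_betw \<rho> UNIV {..<CARD('d)}"
    using ex_bij_betw_finite_nat[of "UNIV :: 'd set"] by (auto simp: atLeast0LessThan)
  \<comment> \<open>The maximum makes the measures up to index \<open>k\<close> share the complement
    of the \<open>k\<close>-dimensional flat, while each later one uses its own.\<close>
  have "\<exists>v p. unitary_frame v \<and> (\<forall>i<CARD('d). \<forall>a\<in>annihilator \<rho> (max i k) v.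
      measure (\<mu> i) {y. a \<bullet> y \<le> a \<bullet> p} \<ge> 1 / real (2 * (CARD('d) - max i k) + 1))"
    by (rule ex_frame_and_center_point[where n = "\<lambda>i. max i k", OF _ _ _ \<rho>])
      (use assms in \<open>simp_all add: less_imp_le\<close>)
  then obtain v p where v: "unitary_frame v"
    and p: "\<And>i a. i < CARD('d) \<Longrightarrow> a \<in> annihilator \<rho> (max i k) v \<Longrightarrow>
      measure (\<mu> i) {y. a \<bullet> y \<le> a \<bullet> p} \<ge> 1 / real (2 * (CARD('d) - max i k) + 1)"
    by blast
  define V where "V i = (\<lambda>w. p + w) ` vec.span (($) v ` {j. \<rho> j < i})" for i
  have aff: "complex_affine_subspace i (V i)" if "i < CARD('d)" for i
    unfolding complex_affine_subspace_def V_def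
    using complex_dim_span_frame[OF v \<rho>, of i] that vec.subspace_span by (metis less_imp_le)
  have tr: "complex_central_transversal (\<mu> i) (max i k) (V (max i k))" if i: "i < CARD('d)" for i
    unfolding complex_central_transversal_def
  proof (intro conjI allI impI)
    show lt: "max i k < CARD('d)" using i assms(1) by simp
    then show "complex_affine_subspace (max i k) (V (max i k))" by (rule aff)
    fix H assume H: "closed_real_halfspace H \<and> V (max i k) \<subseteq> H"
    then obtain a b where ab: "H = {x. a \<bullet> x \<le> b}" by (auto simp: closed_real_halfspace_def)
    then have a: "a \<in> annihilator \<rho> (max i k) v" "a \<bullet> p \<le> b"
      using normal_in_annihilator[of p v \<rho> "max i k" a b] H unfolding V_def by auto
    interpret prob_space "\<mu> i" by (rule assms(2)[OF i])
    have "1 / (2 * real CARD('d) - 2 * real (max i k) + 1) = 1 / real (2 * (CARD('d) - max i k) + 1)"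
      using lt by (simp add: of_nat_diff)
    also have "\<dots> \<le> measure (\<mu> i) {y. a \<bullet> y \<le> a \<bullet> p}" by (rule p[OF i a(1)])
    also have "\<dots> \<le> measure (\<mu> i) H"
      unfolding ab using a(2) by (intro finite_measure_mono) (auto simp: assms(3)[OF i] intro: borel_closed closed_halfspace_le)
    finally show "1 / (2 * real CARD('d) - 2 * real (max i k) + 1) \<le> measure (\<mu> i) H" .
  qed
  show ?thesis
  proof (intro exI[of _ V] conjI allI impI)
    show "V i \<subseteq> V (Suc i)" for i
      unfolding V_def by (intro image_mono vec.span_mono) auto
    show "complex_central_transversal (\<mu> i) k (V k)" if "i \<le> k" for i
      using tr[of i] that assms(1) by (simp add: max_def)
    show "complex_central_transversal (\<mu> i) i (V i)" if "k < i \<and> i < CARD('d)" for i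
      using tr[of i] that by (simp add: max_def split: if_splits)
  qed (use aff in blast)
qed

end
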